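(* Let $\alpha \in (-1,1)$. Let $\varphi$ be a univalent holomorphic self-map of $\mathbb{D}$, and let $\psi \in \mathrm{Hol}(\mathbb{D})$ satisfy (i) $\lim_{|z|\to 1^-}|\psi''(z)|(1-|z|^2)=0$, (ii) $\lim_{|z|\to 1^-}|\varphi'(z)\psi'(z)|(1-|z|^2)=0$, (iii) $\lim_{|z|\to 1^-}|\varphi''(z)\psi(z)|(1-|z|^2)=0$, (iv) $\lim_{|z|\to 1^-}|\varphi'(z)\psi(z)|\left(\frac{1-|z|^2}{1-|\varphi(z)|^2}\right)^{\frac{\alpha}{2}+1}=0$. Then $C_{\psi,\varphi}$ is compact on $\mathcal{D}_{\alpha}$.
   Context: $\mathbb{D}=\{z\in\mathbb{C}:|z|<1\}$ and $\mathrm{Hol}(\mathbb{D})$ is the space of complex-valued holomorphic functions on $\mathbb{D}$. A holomorphic self-map of $\mathbb{D}$ is $\varphi\in\mathrm{Hol}(\mathbb{D})$ with $\varphi(\mathbb{D})\subseteq\mathbb{D}$; univalent means injective. For $\psi\in\mathrm{Hol}(\mathbb{D})$ and a holomorphic self-map $\varphi$, the weighted composition operator is $C_{\psi,\varphi}f=\psi\,(f\circ\varphi)$ for $f\in\mathrm{Hol}(\mathbb{D})$. For $\alpha\in\mathbb{R}$, the weighted Dirichlet space $\mathcal{D}_\alpha$ is the Hilbert space of all $f(z)=\sum_{n\ge 0}a_nz^n\in\mathrm{Hol}(\mathbb{D})$ with $\|f\|_{\mathcal{D}_\alpha}^2=\sum_{n\ge 0}(n+1)^{1-\alpha}|a_n|^2<\infty$,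 with inner product $\langle f,g\rangle_{\mathcal{D}_\alpha}=\sum_{n\ge 0}(n+1)^{1-\alpha}a_n\overline{b_n}$ for $g(z)=\sum_{n\ge0} b_nz^n$. "$C_{\psi,\varphi}$ is compact on $\mathcal{D}_\alpha$" means that it maps $\mathcal{D}_\alpha$ into itself and is a compact linear operator there. *)

theory Defs
  imports "HOL-Complex_Analysis.Complex_Analysis"
begin

abbreviation unit_disc :: "complex set" where
  "unit_disc \<equiv> ball 0 1"

text \<open>
  A holomorphic function on the disc is represented by a total function whose values
  outside the disc are irrelevant; two representatives denote the same function iff they
  agree on the disc.
\<close>

definition holo_self_map :: "(complex \<Rightarrow> complex) \<Rightarrow> bool" where
  "holo_self_map \<phi> \<longleftrightarrow> \<phi> holomorphic_on unit_disc \<and> \<phi> ` unit_disc \<subseteq> unit_disc"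

definition wcomp :: "(complex \<Rightarrow> complex) \<Rightarrow> (complex \<Rightarrow> complex) \<Rightarrow>
    (complex \<Rightarrow> complex) \<Rightarrow> complex \<Rightarrow> complex" where
  "wcomp \<psi> \<phi> f = (\<lambda>z. \<psi> z * f (\<phi> z))"

definition dirichlet_term :: "real \<Rightarrow> (complex \<Rightarrow> complex) \<Rightarrow> nat \<Rightarrow> real" where
  "dirichlet_term \<alpha> f n = (real n + 1) powr (1 - \<alpha>) * (cmod (fps_nth (fps_expansion f 0) n))\<^sup>2"

definition dirichlet_space :: "real \<Rightarrow> (complex \<Rightarrow> complex) set" where
  "dirichlet_space \<alpha> = {f. f holomorphic_on unit_disc \<and> summable (dirichlet_term \<alpha> f)}"

definition dirichlet_norm :: "real \<Rightarrow> (complex \<Rightarrow> complex) \<Rightarrow> real" where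
  "dirichlet_norm \<alpha> f = sqrt (\<Sum>n. dirichlet_term \<alpha> f n)"

text \<open>
  Compactness is stated sequentially: bounded sequences are mapped to sequences having a
  subsequence that converges in norm to an element of the space. The second conjunct says
  that the operator is well defined on functions on the disc (independent of the
  representative).
\<close>

definition compact_operator_on_dirichlet ::
    "real \<Rightarrow> ((complex \<Rightarrow> complex) \<Rightarrow> complex \<Rightarrow> complex) \<Rightarrow> bool" where
  "compact_operator_on_dirichlet \<alpha> T \<longleftrightarrow>
     (\<forall>f \<in> dirichlet_space \<alpha>. T f \<in> dirichlet_space \<alpha>) \<and>
     (\<forall>f \<in> dirichlet_space \<alpha>. \<forall>g \<in> dirichlet_space \<alpha>.
        (\<forall>z \<in> unit_disc. f z = g z) \<longrightarrow> (\<forall>z \<in> unit_disc. T f z = T g z)) \<and>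
     (\<forall>f \<in> dirichlet_space \<alpha>. \<forall>g \<in> dirichlet_space \<alpha>. \<forall>a b. \<forall>z \<in> unit_disc.
        T (\<lambda>w. a * f w + b * g w) z = a * T f z + b * T g z) \<and>
     (\<forall>f :: nat \<Rightarrow> complex \<Rightarrow> complex.
        (\<forall>n. f n \<in> dirichlet_space \<alpha>) \<and> (\<exists>B. \<forall>n. dirichlet_norm \<alpha> (f n) \<le> B) \<longrightarrow>
        (\<exists>g \<in> dirichlet_space \<alpha>. \<exists>r :: nat \<Rightarrow> nat. strict_mono r \<and>
           (\<lambda>n. dirichlet_norm \<alpha> (\<lambda>z. T (f (r n)) z - g z)) \<longlonglongrightarrow> 0))"

text \<open>The filter expressing \<open>|z| \<rightarrow> 1-\<close>, uniformly in the argument of \<open>z\<close>.\<close>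

definition to_unit_circle :: "complex filter" where
  "to_unit_circle = filtercomap cmod (at_left 1)"

end

theory Submission
  imports Defs
begin

text \<open>
  Let \<open>T h = \<psi> (h \<circ> \<phi>)\<close>. Comparing moments of the weights \<open>(1 - \<bar>z\<bar>\<^sup>2)\<^sup>\<beta>\<close> with powers of
  \<open>n + 1\<close> shows that the squared Dirichlet norm of \<open>F\<close> is comparable to
  \<open>\<bar>F(0)\<bar>\<^sup>2 + \<bar>F'(0)\<bar>\<^sup>2\<close> plus the integral of \<open>\<bar>F''\<bar>\<^sup>2\<close> against the weight of exponent \<open>\<alpha> + 2\<close>, and that the integrals of
  \<open>\<bar>h\<bar>\<^sup>2\<close> and \<open>\<bar>h'\<bar>\<^sup>2\<close> against the weight of exponent \<open>\<alpha>\<close> are at most a constant times the squared norm of \<open>h\<close>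
  (\<open>energy_le_bergman_integral\<close> and the three embeddings before it). For \<open>F = T h\<close> the
  second derivative is
  \<open>\<psi>'' (h \<circ> \<phi>) + (2 \<phi>' \<psi>' + \<phi>'' \<psi>) (h' \<circ> \<phi>) + \<phi>' \<psi> \<phi>' (h'' \<circ> \<phi>)\<close>,
  and each of the four boundary conditions makes one of the coefficients small near the unit
  circle. On an annulus next to the circle the integral is therefore at most \<open>\<epsilon>\<^sup>2\<close> times
  three integrals: those of \<open>\<bar>h \<circ> \<phi>\<bar>\<^sup>2\<close> and \<open>\<bar>h' \<circ> \<phi>\<bar>\<^sup>2\<close> with weight exponent \<open>\<alpha>\<close>, and that of
  \<open>\<bar>\<phi>'\<bar>\<^sup>2 \<bar>h'' \<circ> \<phi>\<bar>\<^sup>2\<close> with the weight of exponent \<open>\<alpha> + 2\<close> evaluated at \<open>\<phi>(z)\<close>. The first two are bounded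
  because composition with \<open>\<phi>\<close> is a bounded operator on weighted Bergman spaces
  (\<open>bergman_integral_self_map\<close>, Littlewood's subordination principle); the third one is bounded by a
  change of variables, and this is where univalence enters
  (\<open>nn_integral_univalent_disc_le\<close>).

  So up to \<open>\<epsilon>\<^sup>2\<close> times the squared norm of \<open>h\<close>, the norm of \<open>T h\<close> depends only on its behaviour on a compact subset of the
  disc (\<open>wcomp_energy_estimate\<close>). A bounded sequence has a subsequence that converges locally
  uniformly, by Montel's theorem, to a function in the space; the
  differences \<open>h\<close> to the limit stay bounded and tend to zero on compact sets, hence \<open>T h\<close> tends to zero in
  norm (\<open>compact_wcompI\<close>).

  The Bergman integrals are reduced to Taylor coefficients without polar coordinates: area measure is
  rotation invariant, so that an integrand may be replaced by its averages over circles, and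
  for these both the Parseval identity and Littlewood's inequality follow from one orthogonality
  step (\<open>circle_mean_square_step\<close>), by induction on the number of terms of a polynomial.
\<close>

section \<open>The area formula for univalent functions\<close>

text \<open>
  The change of variables formula is stated for \<open>real ^ 'n\<close> with matrix determinants; this
  linear isometry and its inverse carry it over to the complex plane.
\<close>

definition complex_of_vec :: "real^2 \<Rightarrow> complex" where
  "complex_of_vec v = Complex (vec_nth v 1) (vec_nth v 2)"

definition vec_of_complex :: "complex \<Rightarrow> real^2" where
  "vec_of_complex z = (\<chi> i. if i = 1 then Re z else Im z)"

lemma complex_of_vec_inverse [simp]:
  "complex_of_vec (vec_of_complex z) = z" "vec_of_complex (complex_of_vec v) = v"
  by (auto simp: complex_of_vec_def vec_of_complex_def vec_eq_iff forall_2 complex_eq_iff)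

lemma bounded_linear_complex_of_vec: "bounded_linear complex_of_vec"
  by (intro linear_conv_bounded_linear[THEN iffD1] linearI)
     (auto simp: complex_of_vec_def complex_eq_iff)

lemma bounded_linear_vec_of_complex: "bounded_linear vec_of_complex"
  by (intro linear_conv_bounded_linear[THEN iffD1] linearI)
     (auto simp: vec_of_complex_def vec_eq_iff forall_2)

lemma measurable_complex_of_vec [measurable]: "complex_of_vec \<in> borel_measurable borel"
  by (intro borel_measurable_continuous_onI linear_continuous_on bounded_linear_complex_of_vec)

lemma distr_complex_of_vec: "distr lborel borel complex_of_vec = lborel"
proof (rule lborel_eqI[symmetric])
  fix l u :: complex assume lu: "\<And>b. b \<in> Basis \<Longrightarrow> l \<bullet> b \<le> u \<bullet> b"
  have le: "Re l \<le> Re u" "Im l \<le> Im u" using lu[of 1] lu[of \<i>] by (auto simp: Basis_complex_def)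
  have vim: "complex_of_vec -` box l u = box (vec_of_complex l) (vec_of_complex u)"
    by (auto simp: complex_of_vec_def vec_of_complex_def in_box_complex_iff mem_box_cart forall_2)
  have "emeasure (distr lborel borel complex_of_vec) (box l u)
      = emeasure lborel (box (vec_of_complex l) (vec_of_complex u))"
    by (simp add: emeasure_distr vim)
  also have "\<dots> = emeasure lborel (cbox (vec_of_complex l) (vec_of_complex u))"
    by (simp add: emeasure_lborel_box_eq emeasure_lborel_cbox_eq)
  also have "\<dots> = ennreal (measure lborel (cbox (vec_of_complex l) (vec_of_complex u)))"
    by (rule emeasure_eq_ennreal_measure) (metis emeasure_lborel_cbox_finite less_irrefl infinity_ennreal_def)
  also have "measure lborel (cbox (vec_of_complex l) (vec_of_complex u)) = (Re u - Re l) * (Im u - Im l)"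
    using le by (subst content_cbox_cart) (auto simp: interval_ne_empty_cart forall_2 vec_of_complex_def prod_2 UNIV_2)
  also have "\<dots> = (\<Prod>b\<in>Basis. (u - l) \<bullet> b)" by (simp add: Basis_complex_def)
  finally show "emeasure (distr lborel borel complex_of_vec) (box l u) = (\<Prod>b\<in>Basis. (u - l) \<bullet> b)" .
qed simp

text \<open>
  Multiplication by \<open>c\<close> is a rotation composed with a dilation by \<open>\<bar>c\<bar>\<close>; so the Jacobian
  determinant of a holomorphic function is the squared modulus of its derivative.
\<close>

lemma det_complex_mult:
  "det (matrix (\<lambda>v. vec_of_complex (c * complex_of_vec v))) = (cmod c)\<^sup>2"
  by (simp add: det_2 matrix_def axis_def vec_of_complex_def complex_of_vec_def cmod_power2 flip: power2_eq_square)

text \<open>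
  The Jacobian of \<open>f\<close> is \<open>\<bar>f'\<bar>\<^sup>2\<close> and no point is covered twice, so integrating it over a preimage
  gives the area of the part of the set that \<open>f\<close> reaches. Boundedness of the image keeps all
  measures finite.
\<close>

lemma area_univalent_image:
  assumes hol: "f holomorphic_on S" and S: "open S" and inj: "inj_on f S"
    and bd: "bounded (f ` S)" and B: "B \<in> sets borel"
  shows "(\<integral>\<^sup>+z. indicator (f -` B \<inter> S) z * ennreal ((cmod (deriv f z))\<^sup>2) \<partial>lborel)
         = emeasure lborel (B \<inter> f ` S)"
proof -
  have contf: "continuous_on S f" using hol by (rule holomorphic_on_imp_continuous_on)
  have opn: "open (f ` S)"
    by (rule open_mapping_thm3[OF hol S inj])
  define A where "A = f -` B \<inter> S"
  have A: "A \<in> sets borel"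
  proof -
    have "f \<in> borel_measurable (restrict_space borel S)"
      using contf by (rule borel_measurable_continuous_on_restrict)
    from measurable_sets[OF this B] show ?thesis using S
      by (simp add: A_def space_restrict_space sets_restrict_space_iff)
  qed
  have fA: "f ` A = B \<inter> f ` S" by (auto simp: A_def)
  have fin: "emeasure lborel (B \<inter> f ` S) < \<infinity>"
  proof -
    have "emeasure lborel (B \<inter> f ` S) \<le> emeasure lborel (f ` S)"
      using opn by (intro emeasure_mono) auto
    also have "\<dots> < \<infinity>" using bd by (rule emeasure_bounded_finite)
    finally show ?thesis .
  qed
  define S' where "S' = complex_of_vec -` A"
  define F where "F = (\<lambda>v. vec_of_complex (f (complex_of_vec v)))"
  define F' where "F' = (\<lambda>x v. vec_of_complex (deriv f (complex_of_vec x) * complex_of_vec v))"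
  have S': "S' \<in> sets borel" unfolding S'_def using measurable_sets[OF measurable_complex_of_vec A] by simp
  have der: "(F has_derivative F' x) (at x within S')" if "x \<in> S'" for x
  proof -
    have xS: "complex_of_vec x \<in> S" using that by (auto simp: S'_def A_def)
    have "(f has_field_derivative deriv f (complex_of_vec x)) (at (complex_of_vec x))"
      using holomorphic_derivI[OF hol S xS] .
    hence "(f has_derivative (*) (deriv f (complex_of_vec x))) (at (complex_of_vec x))"
      by (simp add: has_field_derivative_def)
    from has_derivative_compose[OF bounded_linear_imp_has_derivative[OF bounded_linear_complex_of_vec] this]
    have "((\<lambda>v. f (complex_of_vec v)) has_derivative (\<lambda>v. deriv f (complex_of_vec x) * complex_of_vec v)) (at x within S')" .
    from bounded_linear.has_derivative[OF bounded_linear_vec_of_complex this]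
    show ?thesis by (simp add: F_def F'_def)
  qed
  have injF: "inj_on F S'"
  proof (rule inj_onI)
    fix x y assume xy: "x \<in> S'" "y \<in> S'" "F x = F y"
    hence "complex_of_vec (F x) = complex_of_vec (F y)" by simp
    hence "f (complex_of_vec x) = f (complex_of_vec y)" by (simp add: F_def)
    hence "complex_of_vec x = complex_of_vec y"
      using inj xy by (auto simp: S'_def A_def dest: inj_onD)
    hence "vec_of_complex (complex_of_vec x) = vec_of_complex (complex_of_vec y)" by simp
    thus "x = y" by simp
  qed
  have img: "F ` S' = complex_of_vec -` (B \<inter> f ` S)"
  proof (intro set_eqI iffI)
    fix v assume "v \<in> complex_of_vec -` (B \<inter> f ` S)"
    then obtain a where a: "a \<in> A" "complex_of_vec v = f a" unfolding fA[symmetric] by auto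
    hence "vec_of_complex (complex_of_vec v) = vec_of_complex (f a)" by simp
    hence "v = F (vec_of_complex a)" by (simp add: F_def)
    thus "v \<in> F ` S'" using a by (auto simp: S'_def)
  qed (auto simp: F_def S'_def fA[symmetric])
  have em: "emeasure lborel (F ` S') = emeasure lborel (B \<inter> f ` S)"
  proof -
    have "emeasure lborel (B \<inter> f ` S) = emeasure (distr lborel borel complex_of_vec) (B \<inter> f ` S)"
      by (simp add: distr_complex_of_vec)
    also have "\<dots> = emeasure lborel (F ` S')" unfolding img using B opn
      by (subst emeasure_distr) auto
    finally show ?thesis ..
  qed
  have FS: "F ` S' \<in> sets borel" unfolding img
    using measurable_sets[OF measurable_complex_of_vec, of "B \<inter> f ` S"] B opn by simp
  have lm: "F ` S' \<in> lmeasurable" using FS em fin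
    by (intro fmeasurableI) auto
  have "((\<lambda>x. \<bar>det (matrix (F' x))\<bar>) has_integral measure lebesgue (F ` S')) S'"
    using has_measure_differentiable_image[of S' F F' "measure lebesgue (F ` S')"] S' der injF lm
    by simp
  hence "((\<lambda>x. (cmod (deriv f (complex_of_vec x)))\<^sup>2) has_integral measure lebesgue (F ` S')) S'"
    by (simp add: F'_def det_complex_mult)
  from nn_integral_has_integral_lebesgue'[OF _ this]
  have "(\<integral>\<^sup>+x. ennreal ((cmod (deriv f (complex_of_vec x)))\<^sup>2) * indicator S' x \<partial>lborel) 
        = ennreal (measure lebesgue (F ` S'))" by simp
  also have "\<dots> = emeasure lborel (F ` S')"
    using lm FS em fin by (subst emeasure_eq_ennreal_measure[symmetric]) auto
  also note em
  finally have *: "(\<integral>\<^sup>+x. ennreal ((cmod (deriv f (complex_of_vec x)))\<^sup>2) * indicator S' x \<partial>lborel) 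
      = emeasure lborel (B \<inter> f ` S)" .
  have holD: "deriv f holomorphic_on S" using hol S by (rule holomorphic_deriv)
  have meas: "(\<lambda>z. indicator A z * ennreal ((cmod (deriv f z))\<^sup>2)) \<in> borel_measurable borel"
  proof -
    have "deriv f \<in> borel_measurable (restrict_space borel S)"
      by (intro borel_measurable_continuous_on_restrict holomorphic_on_imp_continuous_on holD)
    hence "(\<lambda>z. if z \<in> S then deriv f z else 0) \<in> borel_measurable borel"
      using S by (subst (asm) measurable_restrict_space_iff[where c=0]) auto
    hence "(\<lambda>z. indicator A z * ennreal ((cmod (if z \<in> S then deriv f z else 0))\<^sup>2)) \<in> borel_measurable borel"
      using A by measurable
    also have "(\<lambda>z. indicator A z * ennreal ((cmod (if z \<in> S then deriv f z else 0))\<^sup>2)) = (\<lambda>z. indicator A z * ennreal ((cmod (deriv f z))\<^sup>2))"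
      by (auto simp: A_def indicator_def)
    finally show ?thesis .
  qed
  have "(\<integral>\<^sup>+z. indicator A z * ennreal ((cmod (deriv f z))\<^sup>2) \<partial>distr lborel borel complex_of_vec)
     = (\<integral>\<^sup>+x. indicator A (complex_of_vec x) * ennreal ((cmod (deriv f (complex_of_vec x)))\<^sup>2) \<partial>lborel)"
    by (subst nn_integral_distr) (use meas in auto)
  also have "\<dots> = emeasure lborel (B \<inter> f ` S)"
    unfolding *[symmetric] by (intro nn_integral_cong) (auto simp: S'_def indicator_def)
  finally show ?thesis by (simp add: A_def distr_complex_of_vec)
qed

text \<open>
  The previous lemma says that the push-forward under \<open>f\<close> of the measure with density
  \<open>\<bar>f'\<bar>\<^sup>2\<close> is Lebesgue measure on the image, which is the change of variables formula for all
  nonnegative Borel functions at once, whether or not their integrals are finite.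
\<close>

lemma nn_integral_univalent_image:
  fixes G :: "complex \<Rightarrow> ennreal"
  assumes hol: "f holomorphic_on S" and S: "open S" and inj: "inj_on f S"
    and bd: "bounded (f ` S)" and G[measurable]: "G \<in> borel_measurable borel"
  shows "(\<integral>\<^sup>+z. indicator S z * (ennreal ((cmod (deriv f z))\<^sup>2) * G (f z)) \<partial>lborel)
         = (\<integral>\<^sup>+w. indicator (f ` S) w * G w \<partial>lborel)"
proof -
  define h where "h = (\<lambda>z. if z \<in> S then f z else 0)"
  define d where "d = (\<lambda>z. ennreal ((cmod (if z \<in> S then deriv f z else 0))\<^sup>2))"
  have opn: "open (f ` S)"
    by (rule open_mapping_thm3[OF hol S inj])
  have holD: "deriv f holomorphic_on S" using hol S by (rule holomorphic_deriv)
  have [measurable]: "h \<in> borel_measurable borel"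
  proof -
    have "f \<in> borel_measurable (restrict_space borel S)"
      by (intro borel_measurable_continuous_on_restrict holomorphic_on_imp_continuous_on hol)
    thus ?thesis unfolding h_def
      using S by (subst (asm) measurable_restrict_space_iff[where c=0]) auto
  qed
  have [measurable]: "d \<in> borel_measurable borel"
  proof -
    have "deriv f \<in> borel_measurable (restrict_space borel S)"
      by (intro borel_measurable_continuous_on_restrict holomorphic_on_imp_continuous_on holD)
    hence "(\<lambda>z. if z \<in> S then deriv f z else 0) \<in> borel_measurable borel"
      using S by (subst (asm) measurable_restrict_space_iff[where c=0]) auto
    thus ?thesis unfolding d_def by measurable
  qed
  have [measurable]: "S \<in> sets borel" "f ` S \<in> sets borel" using S opn by auto
  \<comment> \<open>\<open>h\<close> and \<open>d\<close> are Borel versions of \<open>f\<close> and of its Jacobian, set to zero outside \<open>S\<close>.\<close>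
  have eq: "distr (density lborel d) borel h = density lborel (indicator (f ` S))"
  proof (rule measure_eqI)
    fix B assume "B \<in> sets (distr (density lborel d) borel h)"
    hence [measurable]: "B \<in> sets borel" by simp
    have [measurable]: "h -` B \<in> sets borel" using measurable_sets[of h borel borel B] by simp
    have "emeasure (distr (density lborel d) borel h) B = (\<integral>\<^sup>+z. d z * indicator (h -` B) z \<partial>lborel)"
      by (subst emeasure_distr) (auto simp: emeasure_density)
    also have "\<dots> = (\<integral>\<^sup>+z. indicator (f -` B \<inter> S) z * ennreal ((cmod (deriv f z))\<^sup>2) \<partial>lborel)"
      by (intro nn_integral_cong) (auto simp: d_def h_def indicator_def)
    also have "\<dots> = emeasure lborel (B \<inter> f ` S)"
      by (rule area_univalent_image[OF hol S inj bd]) simp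
    also have "\<dots> = emeasure (density lborel (indicator (f ` S))) B"
      by (subst emeasure_density) (auto simp: indicator_inter_arith[symmetric] nn_integral_indicator Int_commute)
    finally show "emeasure (distr (density lborel d) borel h) B = emeasure (density lborel (indicator (f ` S))) B" .
  qed simp
  have "(\<integral>\<^sup>+w. indicator (f ` S) w * G w \<partial>lborel) = (\<integral>\<^sup>+w. G w \<partial>density lborel (indicator (f ` S)))"
    by (subst nn_integral_density) auto
  also have "\<dots> = (\<integral>\<^sup>+z. d z * G (h z) \<partial>lborel)"
    unfolding eq[symmetric] by (subst nn_integral_distr) (auto simp: nn_integral_density)
  also have "\<dots> = (\<integral>\<^sup>+z. indicator S z * (ennreal ((cmod (deriv f z))\<^sup>2) * G (f z)) \<partial>lborel)"
    by (intro nn_integral_cong) (auto simp: d_def h_def indicator_def)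
  finally show ?thesis ..
qed

section \<open>Mean squares over circles\<close>

text \<open>
  Cauchy's integral formula on the unit circle for \<open>w \<mapsto> f (z * w)\<close>. Taking the complex
  number \<open>z\<close> itself as base point of the circle is what makes the averages fit together with
  the rotation invariance of area measure later on.
\<close>

lemma circle_mean_value:
  assumes hol: "f holomorphic_on ball 0 1" and z: "cmod z < 1"
  shows "((\<lambda>t. f (z * cis (2 * pi * t))) has_integral f 0) {0..1}"
proof -
  define g where "g = (\<lambda>w. f (z * w))"
  have "g holomorphic_on cball 0 1"
    unfolding g_def
  proof (rule holomorphic_on_compose_gen[OF _ hol, of "\<lambda>w. z * w", unfolded o_def])
    show "(\<lambda>w. z * w) ` cball 0 1 \<subseteq> ball 0 1"
      using z by (auto simp: norm_mult) (metis mult_le_one norm_ge_zero mult_left_le order.strict_trans1)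
  qed (intro holomorphic_intros)
  hence "((\<lambda>u. g u / (u - 0)) has_contour_integral 2 * of_real pi * \<i> * g 0) (circlepath 0 1)"
    by (intro Cauchy_integral_circlepath_simple) auto
  hence "((\<lambda>t. g (circlepath 0 1 t) / (circlepath 0 1 t) * vector_derivative (circlepath 0 1) (at t)) has_integral 2 * of_real pi * \<i> * g 0) {0..1}"
    by (simp add: has_contour_integral)
  hence "((\<lambda>t. (2 * of_real pi * \<i>) * g (cis (2*pi*t))) has_integral 2 * of_real pi * \<i> * g 0) {0..1}"
    by (rule has_integral_eq[rotated]) (simp only: vector_derivative_circlepath, simp add: circlepath cis_conv_exp field_simps)
  hence "((\<lambda>t. inverse (2 * of_real pi * \<i>) * ((2 * of_real pi * \<i>) * g (cis (2*pi*t)))) has_integral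
     inverse (2 * of_real pi * \<i>) * (2 * of_real pi * \<i> * g 0)) {0..1}"
    by (rule has_integral_mult_right)
  thus ?thesis by (simp add: g_def field_simps)
qed

lemma continuous_on_circle:
  assumes "continuous_on (ball 0 1) f" and "cmod z < 1"
  shows "continuous_on {0..1} (\<lambda>t. f (z * cis (2 * pi * t)))"
  by (rule continuous_on_compose2[OF assms(1)]) (use assms(2) in \<open>auto simp: norm_mult intro!: continuous_intros\<close>)

text \<open>
  If \<open>\<phi>\<close> vanishes at the origin then the product of \<open>\<phi>\<close> and \<open>S\<close> has mean zero on circles, hence
  is orthogonal to constants; this is Pythagoras. It drives both the Parseval identity and
  Littlewood's inequality.
\<close>

lemma circle_mean_square_step:
  assumes h: "\<phi> holomorphic_on ball 0 1" "S holomorphic_on ball 0 1" and "\<phi> 0 = 0" and z: "cmod z < 1"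
  shows "integral {0..1} (\<lambda>t. (cmod (c + \<phi> (z * cis (2*pi*t)) * S (z * cis (2*pi*t))))\<^sup>2)
    = (cmod c)\<^sup>2 + integral {0..1} (\<lambda>t. (cmod (\<phi> (z * cis (2*pi*t)) * S (z * cis (2*pi*t))))\<^sup>2)"
proof -
  define p where "p = (\<lambda>t. \<phi> (z * cis (2*pi*t)) * S (z * cis (2*pi*t)))"
  have hol: "(\<lambda>w. cnj c * (\<phi> w * S w)) holomorphic_on ball 0 1"
    using h by (intro holomorphic_intros)
  have contp: "continuous_on {0..1} p" unfolding p_def
    by (intro continuous_on_mult continuous_on_circle holomorphic_on_imp_continuous_on h z)
  have "((\<lambda>t. cnj c * p t) has_integral 0) {0..1}"
    using circle_mean_value[OF hol z] by (simp add: p_def \<open>\<phi> 0 = 0\<close>)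
  from has_integral_linear[OF this bounded_linear_Re]
  have 1: "((\<lambda>t. 2 * Re (cnj c * p t)) has_integral 2 * 0) {0..1}"
    by (intro has_integral_mult_right) (simp add: o_def)
  have 2: "((\<lambda>t. (cmod (p t))\<^sup>2) has_integral integral {0..1} (\<lambda>t. (cmod (p t))\<^sup>2)) {0..1}"
    by (intro integrable_integral integrable_continuous_interval continuous_intros contp)
  have 3: "((\<lambda>t::real. (cmod c)\<^sup>2) has_integral (cmod c)\<^sup>2) {0..1}"
    using has_integral_const_real[of "(cmod c)\<^sup>2" 0 1] by simp
  have "((\<lambda>t. (cmod c)\<^sup>2 + (cmod (p t))\<^sup>2 + 2 * Re (cnj c * p t)) has_integral
     (cmod c)\<^sup>2 + integral {0..1} (\<lambda>t. (cmod (p t))\<^sup>2) + 2 * 0) {0..1}"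
    by (intro has_integral_add 1 2 3)
  moreover have "(cmod c)\<^sup>2 + (cmod (p t))\<^sup>2 + 2 * Re (cnj c * p t) = (cmod (c + p t))\<^sup>2" for t
    unfolding cmod_power2 by (simp add: power2_eq_square algebra_simps)
  ultimately have "((\<lambda>t. (cmod (c + p t))\<^sup>2) has_integral
     (cmod c)\<^sup>2 + integral {0..1} (\<lambda>t. (cmod (p t))\<^sup>2)) {0..1}" by simp
  from integral_unique[OF this] show ?thesis by (simp add: p_def)
qed

lemma sum_power_Suc_split:
  "(\<Sum>k<Suc N. b k * w ^ k) = b 0 + w * (\<Sum>k<N. b (Suc k) * w ^ k)" for w :: "'a::comm_semiring_1"
  by (simp add: sum.lessThan_Suc_shift sum_distrib_left mult_ac del: sum.lessThan_Suc)

text \<open>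
  Littlewood's inequality for polynomials in \<open>\<phi>\<close>: split off the constant term, drop one factor
  \<open>\<phi>\<close> at the cost of \<open>\<bar>z\<bar>\<^sup>2\<close>, and apply the induction hypothesis to the shifted coefficients.
\<close>

lemma littlewood_polynomial:
  assumes h: "\<phi> holomorphic_on ball 0 1" and "\<phi> 0 = 0" and le: "\<And>w. cmod w < 1 \<Longrightarrow> cmod (\<phi> w) \<le> cmod w"
    and z: "cmod z < 1"
  shows "integral {0..1} (\<lambda>t. (cmod (\<Sum>k<N. b k * \<phi> (z * cis (2*pi*t)) ^ k))\<^sup>2)
    \<le> (\<Sum>k<N. (cmod (b k))\<^sup>2 * ((cmod z)\<^sup>2) ^ k)"
proof (induction N arbitrary: b)
  case (Suc N)
  define S where "S = (\<lambda>w. \<Sum>k<N. b (Suc k) * \<phi> w ^ k)"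
  have hS: "S holomorphic_on ball 0 1" unfolding S_def by (intro holomorphic_intros h)
  let ?w = "\<lambda>t. z * cis (2*pi*t)"
  have cont: "continuous_on {0..1} (\<lambda>t. \<phi> (?w t))" "continuous_on {0..1} (\<lambda>t. S (?w t))"
    by (intro continuous_on_circle holomorphic_on_imp_continuous_on h hS z)+
  have "integral {0..1} (\<lambda>t. (cmod (\<phi> (?w t) * S (?w t)))\<^sup>2) \<le> integral {0..1} (\<lambda>t. (cmod z)\<^sup>2 * (cmod (S (?w t)))\<^sup>2)"
  proof (intro integral_le integrable_continuous_interval continuous_intros cont)
    fix t :: real
    have "cmod (\<phi> (?w t)) \<le> cmod z" using le[of "?w t"] z by (simp add: norm_mult)
    thus "(cmod (\<phi> (?w t) * S (?w t)))\<^sup>2 \<le> (cmod z)\<^sup>2 * (cmod (S (?w t)))\<^sup>2"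
      by (simp add: norm_mult power_mult_distrib mult_right_mono power_mono)
  qed
  also have "\<dots> = (cmod z)\<^sup>2 * integral {0..1} (\<lambda>t. (cmod (S (?w t)))\<^sup>2)" by simp
  also have "\<dots> \<le> (cmod z)\<^sup>2 * (\<Sum>k<N. (cmod (b (Suc k)))\<^sup>2 * ((cmod z)\<^sup>2) ^ k)"
    using Suc.IH[of "\<lambda>k. b (Suc k)"] by (intro mult_left_mono) (simp_all add: S_def)
  finally show ?case
    using circle_mean_square_step[OF h hS \<open>\<phi> 0 = 0\<close> z, of "b 0"]
    unfolding sum_power_Suc_split S_def by simp
qed simp

text \<open>
  The same recursion for the identity function, where dropping a factor costs exactly \<open>\<bar>z\<bar>\<^sup>2\<close>.
\<close>

lemma parseval_polynomial:
  assumes z: "cmod z < 1"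
  shows "integral {0..1} (\<lambda>t. (cmod (\<Sum>k<N. b k * (z * cis (2*pi*t)) ^ k))\<^sup>2)
    = (\<Sum>k<N. (cmod (b k))\<^sup>2 * ((cmod z)\<^sup>2) ^ k)"
proof (induction N arbitrary: b)
  case (Suc N)
  define S where "S = (\<lambda>w. \<Sum>k<N. b (Suc k) * w ^ k)"
  have hS: "S holomorphic_on ball 0 1" unfolding S_def by (intro holomorphic_intros)
  let ?w = "\<lambda>t. z * cis (2*pi*t)"
  have "integral {0..1} (\<lambda>t. (cmod (?w t * S (?w t)))\<^sup>2) = (cmod z)\<^sup>2 * integral {0..1} (\<lambda>t. (cmod (S (?w t)))\<^sup>2)"
    by (simp add: norm_mult power_mult_distrib)
  also have "\<dots> = (cmod z)\<^sup>2 * (\<Sum>k<N. (cmod (b (Suc k)))\<^sup>2 * ((cmod z)\<^sup>2) ^ k)"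
    using Suc.IH[of "\<lambda>k. b (Suc k)"] by (simp add: S_def)
  finally show ?case
    using circle_mean_square_step[OF holomorphic_on_ident hS refl z, of "b 0"]
    unfolding sum_power_Suc_split S_def by simp
qed simp

definition taylor_coeff :: "(complex \<Rightarrow> complex) \<Rightarrow> nat \<Rightarrow> complex" where
  "taylor_coeff f n = (deriv ^^ n) f 0 / fact n"

lemma taylor_coeff_sums:
  assumes "f holomorphic_on ball 0 1" "cmod w < 1"
  shows "(\<lambda>n. taylor_coeff f n * w ^ n) sums f w"
  using holomorphic_power_series[OF assms(1), of w] assms(2) by (simp add: taylor_coeff_def)

lemma taylor_coeff_abs_summable:
  assumes "f holomorphic_on ball 0 1" "0 \<le> r" "r < 1"
  shows "summable (\<lambda>n. cmod (taylor_coeff f n) * r ^ n)"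
proof -
  obtain \<rho> where \<rho>: "r < \<rho>" "\<rho> < 1" using dense[OF assms(3)] by auto
  have "summable (\<lambda>n. taylor_coeff f n * of_real \<rho> ^ n)"
    using taylor_coeff_sums[OF assms(1), of "of_real \<rho>"] \<rho> assms(2) by (auto simp: sums_iff)
  from powser_insidea[OF this, of "of_real r"] show ?thesis
    using \<rho> assms by (simp add: norm_mult norm_power)
qed

text \<open>
  On a fixed circle the Taylor polynomials of \<open>f\<close> in \<open>\<phi>\<close> converge and stay below the absolutely
  convergent series at \<open>\<bar>z\<bar>\<close>, so dominated convergence passes the polynomial statements on to
  \<open>f \<circ> \<phi>\<close>.
\<close>

lemma circle_mean_square_limit:
  assumes f: "f holomorphic_on ball 0 1" and h: "\<phi> holomorphic_on ball 0 1"
    and le: "\<And>w. cmod w < 1 \<Longrightarrow> cmod (\<phi> w) \<le> cmod w" and z: "cmod z < 1"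
  shows "(\<lambda>N. integral {0..1} (\<lambda>t. (cmod (\<Sum>k<N. taylor_coeff f k * \<phi> (z * cis (2*pi*t)) ^ k))\<^sup>2))
      \<longlonglongrightarrow> integral {0..1} (\<lambda>t. (cmod (f (\<phi> (z * cis (2*pi*t)))))\<^sup>2)"
proof (rule dominated_convergence(2))
  let ?w = "\<lambda>t. z * cis (2*pi*t)"
  let ?M = "\<Sum>k. cmod (taylor_coeff f k) * cmod z ^ k"
  have sm: "summable (\<lambda>k. cmod (taylor_coeff f k) * cmod z ^ k)"
    using taylor_coeff_abs_summable[OF f _ z] by simp
  have \<phi>le: "cmod (\<phi> (?w t)) \<le> cmod z" for t :: real using le[of "?w t"] z by (simp add: norm_mult)
  show "(\<lambda>t. (cmod (\<Sum>k<N. taylor_coeff f k * \<phi> (?w t) ^ k))\<^sup>2) integrable_on {0..1}" for N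
    by (intro integrable_continuous_interval continuous_intros continuous_on_circle holomorphic_on_imp_continuous_on h z)
  show "(\<lambda>t::real. ?M\<^sup>2) integrable_on {0..1}"
    by (intro integrable_continuous_interval continuous_intros)
  show "norm ((cmod (\<Sum>k<N. taylor_coeff f k * \<phi> (?w t) ^ k))\<^sup>2) \<le> ?M\<^sup>2" for N and t :: real
  proof -
    have "cmod (\<Sum>k<N. taylor_coeff f k * \<phi> (?w t) ^ k) \<le> (\<Sum>k<N. cmod (taylor_coeff f k) * cmod z ^ k)"
      by (rule sum_norm_le) (auto simp: norm_mult norm_power intro!: mult_left_mono power_mono \<phi>le)
    also have "\<dots> \<le> ?M" by (rule sum_le_suminf[OF sm]) auto
    finally show ?thesis by (simp add: power_mono)
  qed
  show "(\<lambda>N. (cmod (\<Sum>k<N. taylor_coeff f k * \<phi> (?w t) ^ k))\<^sup>2) \<longlonglongrightarrow> (cmod (f (\<phi> (?w t))))\<^sup>2" for t :: real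
    using taylor_coeff_sums[OF f, of "\<phi> (?w t)"] \<phi>le[of t] z unfolding sums_def by (intro tendsto_intros) auto
qed

lemma nn_integral_circle_eq_integral:
  assumes "continuous_on (ball 0 1) g" "cmod z < 1" "\<And>w. 0 \<le> g w"
  shows "(\<integral>\<^sup>+t. ennreal (g (z * cis (2*pi*t))) * indicator {0..1} t \<partial>lborel)
     = ennreal (integral {0..1} (\<lambda>t. g (z * cis (2*pi*t))))"
  by (intro nn_integral_has_integral_lebesgue' integrable_integral integrable_continuous_interval 
       continuous_on_circle) (use assms in auto)

lemma parseval_circle:
  assumes f: "f holomorphic_on ball 0 1" and z: "cmod z < 1"
  shows "(\<integral>\<^sup>+t. ennreal ((cmod (f (z * cis (2*pi*t))))\<^sup>2) * indicator {0..1} t \<partial>lborel)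
     = (\<Sum>n. ennreal ((cmod (taylor_coeff f n))\<^sup>2 * ((cmod z)\<^sup>2) ^ n))"
proof -
  let ?I = "integral {0..1} (\<lambda>t. (cmod (f (z * cis (2*pi*t))))\<^sup>2)"
  have "(\<lambda>n. (cmod (taylor_coeff f n))\<^sup>2 * ((cmod z)\<^sup>2) ^ n) sums ?I"
    using circle_mean_square_limit[OF f holomorphic_on_ident _ z]
    unfolding sums_def parseval_polynomial[OF z] by simp
  hence "(\<Sum>n. ennreal ((cmod (taylor_coeff f n))\<^sup>2 * ((cmod z)\<^sup>2) ^ n)) = ennreal ?I"
    by (subst suminf_ennreal_eq) auto
  moreover have "(\<integral>\<^sup>+t. ennreal ((cmod (f (z * cis (2*pi*t))))\<^sup>2) * indicator {0..1} t \<partial>lborel) = ennreal ?I"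
    by (rule nn_integral_circle_eq_integral[OF _ z, of "\<lambda>w. (cmod (f w))\<^sup>2"])
       (auto intro!: continuous_intros holomorphic_on_imp_continuous_on f)
  ultimately show ?thesis by simp
qed

text \<open>
  The limit of the polynomial case. The coefficient sum that bounds the mean square of \<open>f \<circ> \<phi>\<close> is, by
  Parseval, the mean square of \<open>f\<close> itself.
\<close>

lemma littlewood_circle:
  assumes f: "f holomorphic_on ball 0 1" and h: "\<phi> holomorphic_on ball 0 1" and 0: "\<phi> 0 = 0"
    and le: "\<And>w. cmod w < 1 \<Longrightarrow> cmod (\<phi> w) \<le> cmod w" and z: "cmod z < 1"
  shows "(\<integral>\<^sup>+t. ennreal ((cmod (f (\<phi> (z * cis (2*pi*t)))))\<^sup>2) * indicator {0..1} t \<partial>lborel)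
     \<le> (\<integral>\<^sup>+t. ennreal ((cmod (f (z * cis (2*pi*t))))\<^sup>2) * indicator {0..1} t \<partial>lborel)"
proof -
  let ?w = "\<lambda>t. z * cis (2*pi*t)"
  have "integral {0..1} (\<lambda>t. (cmod (f (\<phi> (?w t))))\<^sup>2) \<le> integral {0..1} (\<lambda>t. (cmod (f (?w t)))\<^sup>2)"
  proof (rule LIMSEQ_le)
    show "(\<lambda>N. integral {0..1} (\<lambda>t. (cmod (\<Sum>k<N. taylor_coeff f k * \<phi> (?w t) ^ k))\<^sup>2))
      \<longlonglongrightarrow> integral {0..1} (\<lambda>t. (cmod (f (\<phi> (?w t))))\<^sup>2)"
      by (rule circle_mean_square_limit[OF f h le z])
    show "(\<lambda>N. integral {0..1} (\<lambda>t. (cmod (\<Sum>k<N. taylor_coeff f k * ?w t ^ k))\<^sup>2))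
      \<longlonglongrightarrow> integral {0..1} (\<lambda>t. (cmod (f (?w t)))\<^sup>2)"
      by (rule circle_mean_square_limit[OF f holomorphic_on_ident _ z]) simp
  qed (use littlewood_polynomial[OF h 0 le z] parseval_polynomial[OF z] in simp)
  moreover have "(\<integral>\<^sup>+t. ennreal ((cmod (f (?w t)))\<^sup>2) * indicator {0..1} t \<partial>lborel) 
      = ennreal (integral {0..1} (\<lambda>t. (cmod (f (?w t)))\<^sup>2))"
    by (rule nn_integral_circle_eq_integral[OF _ z, of "\<lambda>w. (cmod (f w))\<^sup>2"])
       (auto intro!: continuous_intros holomorphic_on_imp_continuous_on f)
  moreover have "(\<integral>\<^sup>+t. ennreal ((cmod (f (\<phi> (?w t))))\<^sup>2) * indicator {0..1} t \<partial>lborel) 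
      = ennreal (integral {0..1} (\<lambda>t. (cmod (f (\<phi> (?w t))))\<^sup>2))"
  proof (rule nn_integral_circle_eq_integral[OF _ z, of "\<lambda>w. (cmod (f (\<phi> w)))\<^sup>2"])
    have "f \<circ> \<phi> holomorphic_on ball 0 1"
      by (intro holomorphic_on_compose_gen[OF h f]) (auto intro: order.strict_trans1[OF le])
    thus "continuous_on (ball 0 1) (\<lambda>w. (cmod (f (\<phi> w)))\<^sup>2)"
      by (intro continuous_intros holomorphic_on_imp_continuous_on) (simp add: o_def)
  qed auto
  ultimately show ?thesis by (simp add: ennreal_leI)
qed

section \<open>Weighted Bergman integrals and Taylor coefficients\<close>

lemma sets_disc [measurable]: "ball (0::complex) 1 \<in> sets borel"
  by simp

lemma measurable_disc_function:
  fixes f :: "complex \<Rightarrow> 'a::real_normed_vector"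
  assumes "continuous_on (ball 0 1) f"
  shows "(\<lambda>z. if z \<in> ball 0 1 then f z else 0) \<in> borel_measurable borel"
proof -
  have "f \<in> borel_measurable (restrict_space borel (ball 0 1))"
    by (intro borel_measurable_continuous_on_restrict assms)
  thus ?thesis by (subst (asm) measurable_restrict_space_iff[where c=0]) auto
qed

text \<open>
  A rotation is univalent, maps the disc onto itself and has derivative of modulus one.
\<close>

lemma nn_integral_disc_rotate:
  fixes G :: "complex \<Rightarrow> ennreal"
  assumes G[measurable]: "G \<in> borel_measurable borel" and c: "cmod c = 1"
  shows "(\<integral>\<^sup>+z. indicator (ball 0 1) z * G (z * c) \<partial>lborel) = (\<integral>\<^sup>+z. indicator (ball 0 1) z * G z \<partial>lborel)"
proof -
  have c0: "c \<noteq> 0" using c by auto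
  have img: "(\<lambda>z. z * c) ` ball 0 1 = ball 0 1"
  proof (intro set_eqI iffI)
    fix w :: complex assume "w \<in> ball 0 1"
    hence "w / c \<in> ball 0 1" "w = (w / c) * c" using c c0 by (auto simp: norm_divide)
    thus "w \<in> (\<lambda>z. z * c) ` ball 0 1" by blast
  qed (use c in \<open>auto simp: norm_mult\<close>)
  have "deriv (\<lambda>z. z * c) z = c" for z by (rule DERIV_imp_deriv) (auto intro!: derivative_eq_intros)
  moreover have "(\<integral>\<^sup>+z. indicator (ball 0 1) z * (ennreal ((cmod (deriv (\<lambda>z. z * c) z))\<^sup>2) * G (z * c)) \<partial>lborel)
     = (\<integral>\<^sup>+w. indicator ((\<lambda>z. z * c) ` ball 0 1) w * G w \<partial>lborel)"
    by (rule nn_integral_univalent_image) (auto simp: img c0 inj_on_def intro!: holomorphic_intros)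
  ultimately show ?thesis by (simp add: c img)
qed

text \<open>
  Averaging the rotation invariance over all angles and exchanging the integrals replaces \<open>G\<close> by
  its circle averages. It serves as a substitute for polar coordinates against radial weights.
\<close>

lemma nn_integral_disc_circle_average:
  fixes G :: "complex \<Rightarrow> ennreal" and W :: "real \<Rightarrow> ennreal"
  assumes G[measurable]: "G \<in> borel_measurable borel" and W[measurable]: "W \<in> borel_measurable borel"
  shows "(\<integral>\<^sup>+z. indicator (ball 0 1) z * (G z * W (cmod z)) \<partial>lborel)
    = (\<integral>\<^sup>+z. indicator (ball 0 1) z * ((\<integral>\<^sup>+t. G (z * cis (2*pi*t)) * indicator {0..1} t \<partial>lborel) * W (cmod z)) \<partial>lborel)"
proof -
  have [measurable]: "cis \<in> borel_measurable borel"
    by (intro borel_measurable_continuous_onI continuous_intros)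
  have 1: "(\<integral>\<^sup>+z. indicator (ball 0 1) z * (G (z * cis (2*pi*t)) * W (cmod z)) \<partial>lborel)
     = (\<integral>\<^sup>+z. indicator (ball 0 1) z * (G z * W (cmod z)) \<partial>lborel)" for t :: real
    using nn_integral_disc_rotate[of "\<lambda>z. G z * W (cmod z)" "cis (2*pi*t)"] by (simp add: norm_mult)
  have "(\<integral>\<^sup>+z. indicator (ball 0 1) z * (G z * W (cmod z)) \<partial>lborel)
      = (\<integral>\<^sup>+t. (\<integral>\<^sup>+z. indicator (ball 0 1) z * (G z * W (cmod z)) \<partial>lborel) * indicator {0..1::real} t \<partial>lborel)"
    by (subst nn_integral_cmult_indicator) auto
  also have "\<dots> = (\<integral>\<^sup>+t. (\<integral>\<^sup>+z. indicator (ball 0 1) z * (G (z * cis (2*pi*t)) * W (cmod z)) \<partial>lborel) * indicator {0..1} t \<partial>lborel)"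
    by (simp add: 1)
  also have "\<dots> = (\<integral>\<^sup>+t. (\<integral>\<^sup>+z. indicator (ball 0 1) z * (G (z * cis (2*pi*t)) * W (cmod z)) * indicator {0..1} t \<partial>lborel) \<partial>lborel)"
    by (intro nn_integral_cong nn_integral_multc[symmetric]) measurable
  also have "\<dots> = (\<integral>\<^sup>+z. (\<integral>\<^sup>+t. indicator (ball 0 1) z * (G (z * cis (2*pi*t)) * W (cmod z)) * indicator {0..1} t \<partial>lborel) \<partial>lborel)"
    by (rule lborel_pair.Fubini') measurable
  also have "\<dots> = (\<integral>\<^sup>+z. (\<integral>\<^sup>+t. (indicator (ball 0 1) z * W (cmod z)) * (G (z * cis (2*pi*t)) * indicator {0..1} t) \<partial>lborel) \<partial>lborel)"
    by (simp add: mult_ac)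
  also have "\<dots> = (\<integral>\<^sup>+z. (indicator (ball 0 1) z * W (cmod z)) * (\<integral>\<^sup>+t. (G (z * cis (2*pi*t)) * indicator {0..1} t) \<partial>lborel) \<partial>lborel)"
    by (intro nn_integral_cong nn_integral_cmult) measurable
  finally show ?thesis by (simp add: mult_ac)
qed

text \<open>
  The squared norm of the weighted Bergman space with weight \<open>(1 - \<bar>z\<bar>\<^sup>2)\<^sup>\<beta>\<close> and unnormalised area
  measure; it is infinite for functions outside the space.
\<close>

definition bergman_integral :: "real \<Rightarrow> (complex \<Rightarrow> complex) \<Rightarrow> ennreal" where
  "bergman_integral \<beta> f = (\<integral>\<^sup>+z. indicator (ball 0 1) z * ennreal ((cmod (f z))\<^sup>2 * (1 - (cmod z)\<^sup>2) powr \<beta>) \<partial>lborel)"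

definition bergman_moment :: "real \<Rightarrow> nat \<Rightarrow> ennreal" where
  "bergman_moment \<beta> n = (\<integral>\<^sup>+z. indicator (ball 0 1) z * ennreal (((cmod z)\<^sup>2) ^ n * (1 - (cmod z)\<^sup>2) powr \<beta>) \<partial>lborel)"

lemma bergman_integral_circle:
  assumes f: "continuous_on (ball 0 1) f"
  shows "bergman_integral \<beta> f = (\<integral>\<^sup>+z. indicator (ball 0 1) z *
    ((\<integral>\<^sup>+t. ennreal ((cmod (f (z * cis (2*pi*t))))\<^sup>2) * indicator {0..1} t \<partial>lborel) * ennreal ((1 - (cmod z)\<^sup>2) powr \<beta>)) \<partial>lborel)"
proof -
  note [measurable] = measurable_disc_function[OF f]
  let ?G = "\<lambda>z. ennreal ((cmod (if z \<in> ball 0 1 then f z else 0))\<^sup>2)"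
  let ?W = "\<lambda>r. ennreal ((1 - r\<^sup>2) powr \<beta>)"
  have "bergman_integral \<beta> f = (\<integral>\<^sup>+z. indicator (ball 0 1) z * (?G z * ?W (cmod z)) \<partial>lborel)"
    unfolding bergman_integral_def by (intro nn_integral_cong) (auto simp: indicator_def ennreal_mult)
  also have "\<dots> = (\<integral>\<^sup>+z. indicator (ball 0 1) z * ((\<integral>\<^sup>+t. ?G (z * cis (2*pi*t)) * indicator {0..1} t \<partial>lborel) * ?W (cmod z)) \<partial>lborel)"
    by (rule nn_integral_disc_circle_average) measurable
  also have "\<dots> = (\<integral>\<^sup>+z. indicator (ball 0 1) z * ((\<integral>\<^sup>+t. ennreal ((cmod (f (z * cis (2*pi*t))))\<^sup>2) * indicator {0..1} t \<partial>lborel) * ?W (cmod z)) \<partial>lborel)"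
    by (intro nn_integral_cong) (auto simp: indicator_def norm_mult)
  finally show ?thesis .
qed

text \<open>
  Integrating the Parseval identity over the radii: monomials are orthogonal for every radial
  weight, so only the moments of the weight matter.
\<close>

lemma bergman_integral_coeffs:
  assumes f: "f holomorphic_on ball 0 1"
  shows "bergman_integral \<beta> f = (\<Sum>n. ennreal ((cmod (taylor_coeff f n))\<^sup>2) * bergman_moment \<beta> n)"
proof -
  have "bergman_integral \<beta> f = (\<integral>\<^sup>+z. (\<Sum>n. ennreal ((cmod (taylor_coeff f n))\<^sup>2) *
      (indicator (ball 0 1) z * ennreal (((cmod z)\<^sup>2) ^ n * (1 - (cmod z)\<^sup>2) powr \<beta>))) \<partial>lborel)"
    unfolding bergman_integral_circle[OF holomorphic_on_imp_continuous_on[OF f]]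
  proof (intro nn_integral_cong)
    fix z :: complex
    show "indicator (ball 0 1) z * ((\<integral>\<^sup>+t. ennreal ((cmod (f (z * cis (2*pi*t))))\<^sup>2) * indicator {0..1} t \<partial>lborel) * ennreal ((1 - (cmod z)\<^sup>2) powr \<beta>))
     = (\<Sum>n. ennreal ((cmod (taylor_coeff f n))\<^sup>2) *
      (indicator (ball 0 1) z * ennreal (((cmod z)\<^sup>2) ^ n * (1 - (cmod z)\<^sup>2) powr \<beta>)))"
    proof (cases "cmod z < 1")
      case True
      show ?thesis unfolding parseval_circle[OF f True] using True
        by (simp add: ennreal_mult mult.assoc ennreal_suminf_multc[symmetric] flip: ennreal_power)
    qed simp
  qed
  also have "\<dots> = (\<Sum>n. ennreal ((cmod (taylor_coeff f n))\<^sup>2) * bergman_moment \<beta> n)"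
    unfolding bergman_moment_def by (subst nn_integral_suminf) (auto simp: nn_integral_cmult)
  finally show ?thesis .
qed

text \<open>
  By the Schwarz lemma \<open>\<phi>\<close> satisfies Littlewood's hypothesis on every circle, and the inequality
  survives integration against the radial weight.
\<close>

lemma bergman_integral_subordinate:
  assumes f: "f holomorphic_on ball 0 1" and h: "\<phi> holomorphic_on ball 0 1" and 0: "\<phi> 0 = 0"
    and self: "\<And>w. cmod w < 1 \<Longrightarrow> cmod (\<phi> w) < 1"
  shows "bergman_integral \<beta> (\<lambda>z. f (\<phi> z)) \<le> bergman_integral \<beta> f"
proof -
  have le: "cmod (\<phi> w) \<le> cmod w" if "cmod w < 1" for w
    using Schwarz_Lemma(1)[OF h 0 self that] .
  have "f \<circ> \<phi> holomorphic_on ball 0 1"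
    by (intro holomorphic_on_compose_gen[OF h f]) (auto intro: self)
  hence c: "continuous_on (ball 0 1) (\<lambda>z. f (\<phi> z))"
    by (intro holomorphic_on_imp_continuous_on) (simp add: o_def)
  show ?thesis
    unfolding bergman_integral_circle[OF c] bergman_integral_circle[OF holomorphic_on_imp_continuous_on[OF f]]
    proof (intro nn_integral_mono)
    fix z :: complex
    show "indicator (ball 0 1) z * ((\<integral>\<^sup>+t. ennreal ((cmod (f (\<phi> (z * cis (2*pi*t)))))\<^sup>2) * indicator {0..1} t \<partial>lborel) * ennreal ((1 - (cmod z)\<^sup>2) powr \<beta>))
      \<le> indicator (ball 0 1) z * ((\<integral>\<^sup>+t. ennreal ((cmod (f (z * cis (2*pi*t))))\<^sup>2) * indicator {0..1} t \<partial>lborel) * ennreal ((1 - (cmod z)\<^sup>2) powr \<beta>))"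
      by (cases "cmod z < 1") (auto intro!: mult_right_mono littlewood_circle[OF f h 0 le])
  qed
qed

lemma emeasure_unit_disc: "emeasure lborel (ball (0::complex) 1) = ennreal pi"
  by (subst emeasure_ball) (auto simp: unit_ball_vol_2)

text \<open>
  A disc of radius \<open>\<surd>x\<close> has area \<open>\<pi> x\<close>; hence \<open>\<bar>z\<bar>\<^sup>2\<close> is uniformly distributed over the
  unit interval with total mass \<open>\<pi>\<close>.
\<close>

lemma distr_disc_norm_square:
  "distr (density lborel (indicator (ball 0 1))) borel (\<lambda>z::complex. (cmod z)\<^sup>2) = density lborel (\<lambda>t. ennreal pi * indicator {0..1} t)"
  (is "?M = ?N")
proof (rule measure_eqI_lessThan)
  have M: "emeasure ?M {x<..} = emeasure lborel (ball (0::complex) 1 - cball 0 (sqrt x))" if "0 \<le> x" for x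
  proof -
    have "emeasure ?M {x<..} = emeasure (density lborel (indicator (ball 0 1))) ((\<lambda>z::complex. (cmod z)\<^sup>2) -` {x<..})"
      by (subst emeasure_distr) auto
    also have "(\<lambda>z::complex. (cmod z)\<^sup>2) -` {x<..} = - cball 0 (sqrt x)"
    proof -
      have "(cmod z)\<^sup>2 \<le> x \<longleftrightarrow> cmod z \<le> sqrt x" for z
        by (metis real_le_rsqrt sqrt_ge_absD abs_norm_cancel)
      thus ?thesis by (auto simp: not_le[symmetric])
    qed
    also have "emeasure (density lborel (indicator (ball 0 1))) (- cball (0::complex) (sqrt x)) = emeasure lborel (ball (0::complex) 1 - cball 0 (sqrt x))"
      by (subst emeasure_density) (auto simp: Diff_eq simp flip: indicator_inter_arith)
    finally show ?thesis .
  qed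
  have N: "emeasure ?N {x<..} = ennreal (pi * (1 - max 0 x))" if "x \<le> 1" for x
  proof -
    have "emeasure ?N {x<..} = (\<integral>\<^sup>+t. ennreal pi * indicator ({0..1} \<inter> {x<..}) t \<partial>lborel)"
      by (subst emeasure_density) (auto simp: indicator_inter_arith mult_ac intro!: nn_integral_cong)
    also have "\<dots> = ennreal pi * emeasure lborel ({0..1} \<inter> {x<..})"
      by (subst nn_integral_cmult_indicator) auto
    also have "{0..1} \<inter> {x<..} = (if x < 0 then {0..1} else {x<..1})" using that by auto
    also have "emeasure lborel \<dots> = ennreal (1 - max 0 x)" using that by auto
    finally show ?thesis using that by (simp add: ennreal_mult)
  qed
  note disc = emeasure_unit_disc
  have cdisc: "emeasure lborel (cball (0::complex) (sqrt x)) = ennreal (pi * x)" if "0 \<le> x" for x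
    using that by (subst emeasure_cball) (auto simp: unit_ball_vol_2)
  show eq: "emeasure ?M {x<..} = emeasure ?N {x<..}" for x
  proof (cases "x < 0")
    case True
    have "emeasure ?M {x<..} = emeasure (density lborel (indicator (ball 0 1))) ((\<lambda>z::complex. (cmod z)\<^sup>2) -` {x<..})"
      by (subst emeasure_distr) auto
    also have "(\<lambda>z::complex. (cmod z)\<^sup>2) -` {x<..} = UNIV" using True by (auto intro: less_le_trans[OF _ zero_le_power2])
    also have "emeasure (density lborel (indicator (ball 0 1))) (UNIV::complex set) = ennreal pi"
      by (subst emeasure_density) (auto simp: disc)
    finally show ?thesis using N[of x] True by simp
  next
    case False
    show ?thesis
    proof (cases "x \<le> 1")
      case True
      show ?thesis
      proof (cases "x = 1")
        case True
        have e: "ball (0::complex) 1 - cball 0 (sqrt x) = {}" using True by auto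
        have x0: "0 \<le> x" using True by simp
        show ?thesis unfolding M[OF x0] e using N[of x] True by simp
      next
        case x1: False
        have sub: "cball (0::complex) (sqrt x) \<subseteq> ball 0 1" using False x1 True by (auto simp: subset_iff intro: le_less_trans)
        have "emeasure ?M {x<..} = emeasure lborel (ball (0::complex) 1) - emeasure lborel (cball (0::complex) (sqrt x))"
          using M[of x] False by (subst emeasure_Diff[symmetric]) (auto simp: sub cdisc)
        also have "\<dots> = ennreal (pi * (1 - x))" using False True
          by (simp add: disc cdisc ennreal_minus algebra_simps)
        finally show ?thesis using N[of x] True False by simp
      qed
    next
      case x1: False
      have s: "sqrt x > 1" using x1 by simp
      have e: "ball (0::complex) 1 - cball 0 (sqrt x) = {}" by (auto intro: less_imp_le[OF less_trans[OF _ s]])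
      have N0: "emeasure ?N {x<..} = 0"
      proof -
        have "emeasure ?N {x<..} = (\<integral>\<^sup>+t. ennreal pi * indicator {0..1} t * indicator {x<..} t \<partial>lborel)"
          by (subst emeasure_density) auto
        also have "\<dots> = (\<integral>\<^sup>+t. 0 \<partial>(lborel::real measure))"
          by (intro nn_integral_cong) (use x1 in \<open>auto simp: indicator_def\<close>)
        finally have "emeasure ?N {x<..} = (\<integral>\<^sup>+t. 0 \<partial>(lborel::real measure))" .
        thus ?thesis by simp
      qed
      have x0: "0 \<le> x" using x1 by simp
      show ?thesis unfolding M[OF x0] e N0 by simp
    qed
  qed
  show "emeasure ?M {x<..} < \<infinity>" for x
  proof (cases "x \<le> 1")
    case True thus ?thesis using N[of x] by (simp add: eq)
  next
    case False
    have "emeasure ?N {x<..} \<le> emeasure ?N {1<..}" using False by (intro emeasure_mono) auto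
    also have "\<dots> < \<infinity>" using N[of 1] by simp
    finally show ?thesis by (simp add: eq)
  qed
qed auto

lemma bergman_moment_Beta:
  assumes "\<beta> > -1"
  shows "bergman_moment \<beta> n = ennreal (pi * Beta (real n + 1) (\<beta> + 1))"
proof -
  let ?h = "\<lambda>t::real. t ^ n * (1 - t) powr \<beta>"
  have "bergman_moment \<beta> n = (\<integral>\<^sup>+z. ennreal (?h ((cmod z)\<^sup>2)) \<partial>density lborel (indicator (ball 0 1)))"
    unfolding bergman_moment_def by (subst nn_integral_density) auto
  also have "\<dots> = (\<integral>\<^sup>+t. ennreal (?h t) \<partial>density lborel (\<lambda>t. ennreal pi * indicator {0..1} t))"
    unfolding distr_disc_norm_square[symmetric] by (subst nn_integral_distr) auto
  also have "\<dots> = (\<integral>\<^sup>+t. ennreal pi * (ennreal (?h t) * indicator {0..1} t) \<partial>lborel)"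
    by (subst nn_integral_density) (auto simp: mult_ac)
  also have "\<dots> = ennreal pi * (\<integral>\<^sup>+t. ennreal (?h t) * indicator {0..1} t \<partial>lborel)"
    by (rule nn_integral_cmult) auto
  also have "(\<integral>\<^sup>+t. ennreal (?h t) * indicator {0..1} t \<partial>lborel) = ennreal (Beta (real n + 1) (\<beta> + 1))"
  proof (rule nn_integral_has_integral_lebesgue')
    have "((\<lambda>t. t powr (real n + 1 - 1) * (1 - t) powr (\<beta> + 1 - 1)) has_integral Beta (real n + 1) (\<beta> + 1)) {0..1}"
      using assms by (intro has_integral_Beta_real) auto
    \<comment> \<open>At the origin \<open>0 powr 0 = 0\<close> whereas \<open>0 ^ 0 = 1\<close>; one point does not matter.\<close>
    thus "(?h has_integral Beta (real n + 1) (\<beta> + 1)) {0..1}"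
      by (rule has_integral_spike_finite[of "{0}", rotated -1]) (auto simp: powr_realpow)
  qed auto
  also have "ennreal pi * \<dots> = ennreal (pi * Beta (real n + 1) (\<beta> + 1))"
    by (rule ennreal_mult'[symmetric]) auto
  finally show ?thesis .
qed

text \<open>
  Since \<open>B(n + 1, z)\<close> equals \<open>n! / (z (z + 1) \<dots> (z + n))\<close>, this is
  the product limit for the Gamma function.
\<close>

lemma Beta_real_asymptotics:
  assumes "z > (0::real)"
  shows "(\<lambda>n. (real n + 1) powr z * Beta (real n + 1) z) \<longlonglongrightarrow> Gamma z"
proof -
  have znp: "z \<notin> \<int>\<^sub>\<le>\<^sub>0" using assms by (auto elim!: nonpos_Ints_cases)
  have "(\<lambda>n. ((real n + 1) / real n) powr z * inverse (rGamma_series z n)) \<longlonglongrightarrow> 1 powr z * inverse (rGamma z)"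
  proof (intro tendsto_intros)
    show "(\<lambda>n. (real n + 1) / real n) \<longlonglongrightarrow> 1" using LIMSEQ_Suc_n_over_n[where 'a=real] by (simp add: add.commute)
    show "rGamma z \<noteq> 0" using znp by (simp add: rGamma_eq_zero_iff)
  qed auto
  hence "(\<lambda>n. ((real n + 1) / real n) powr z * inverse (rGamma_series z n)) \<longlonglongrightarrow> Gamma z"
    by (simp add: rGamma_inverse_Gamma)
  moreover have "eventually (\<lambda>n. ((real n + 1) / real n) powr z * inverse (rGamma_series z n) = (real n + 1) powr z * Beta (real n + 1) z) sequentially"
    using eventually_gt_at_top[of 0]
  proof eventually_elim
    fix n :: nat assume n: "n > 0"
    have "Beta (real n + 1) z = fact n * Gamma z / Gamma (z + of_nat (n + 1))"
      using Gamma_fact[of n, where 'a=real] by (simp add: Beta_def algebra_simps)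
    also have "\<dots> = fact n / pochhammer z (n + 1)"
      using pochhammer_Gamma[OF znp, of "n+1"] znp by (simp add: Gamma_eq_zero_iff)
    finally have B: "Beta (real n + 1) z = fact n / pochhammer z (n + 1)" .
    have "exp (z * ln (real n)) = real n powr z" using n by (simp add: powr_def)
    thus "((real n + 1) / real n) powr z * inverse (rGamma_series z n) = (real n + 1) powr z * Beta (real n + 1) z"
      unfolding B rGamma_series_def using n by (simp add: powr_divide field_simps)
  qed
  ultimately show ?thesis by (rule Lim_transform_eventually)
qed

lemma positive_convergent_bounds:
  fixes s :: "nat \<Rightarrow> real"
  assumes "s \<longlonglongrightarrow> L" "L > 0" "\<And>n. s n > 0"
  obtains c C where "0 < c" "0 < C" "\<And>n. c \<le> s n" "\<And>n. s n \<le> C"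
proof -
  have "Bseq s" using assms(1) by (metis convergent_imp_Bseq convergentI)
  then obtain C where C: "C > 0" "\<And>n. norm (s n) \<le> C" by (auto elim: BseqE)
  have "(\<lambda>n. inverse (s n)) \<longlonglongrightarrow> inverse L" using assms by (intro tendsto_intros) auto
  hence "Bseq (\<lambda>n. inverse (s n))" by (metis convergent_imp_Bseq convergentI)
  then obtain D where D: "D > 0" "\<And>n. norm (inverse (s n)) \<le> D" by (auto elim: BseqE)
  have "inverse D \<le> s n" for n
    using D(2)[of n] D(1) assms(3)[of n] by (simp add: field_simps)
  moreover have "s n \<le> C" for n using C(2)[of n] assms(3)[of n] by simp
  ultimately show ?thesis using that[of "inverse D" C] C(1) D(1) by auto
qed

text \<open>
  The moments are Beta values, so they are comparable to \<open>(n + 1)\<close> raised to the power \<open>-(\<beta> + 1)\<close>. This is the only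
  information about the weight that enters the comparison of norms.
\<close>

lemma bergman_moment_bounds:
  assumes "\<beta> > -1"
  obtains c C where "0 < c" "0 < C"
    "\<And>n. ennreal (c * (real n + 1) powr (-(\<beta>+1))) \<le> bergman_moment \<beta> n"
    "\<And>n. bergman_moment \<beta> n \<le> ennreal (C * (real n + 1) powr (-(\<beta>+1)))"
proof -
  define s where "s = (\<lambda>n. (real n + 1) powr (\<beta>+1) * Beta (real n + 1) (\<beta>+1))"
  have pos: "s n > 0" for n using assms by (auto simp: s_def Beta_def intro!: mult_pos_pos divide_pos_pos Gamma_real_pos)
  have lim: "s \<longlonglongrightarrow> Gamma (\<beta>+1)" unfolding s_def using assms by (intro Beta_real_asymptotics) auto
  obtain c C where cC: "0 < c" "0 < C" "\<And>n. c \<le> s n" "\<And>n. s n \<le> C"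
    using positive_convergent_bounds[OF lim _ pos] assms Gamma_real_pos[of "\<beta>+1"] by auto
  have m: "bergman_moment \<beta> n = ennreal (pi * s n * (real n + 1) powr (-(\<beta>+1)))" for n
  proof -
    have "(real n + 1) powr (\<beta>+1) * (real n + 1) powr (-(\<beta>+1)) = 1"
      by (simp only: powr_add[symmetric]) simp
    moreover have "pi * s n * (real n + 1) powr (-(\<beta>+1))
      = pi * Beta (real n + 1) (\<beta> + 1) * ((real n + 1) powr (\<beta>+1) * (real n + 1) powr (-(\<beta>+1)))"
      by (simp only: s_def mult_ac)
    ultimately show ?thesis by (simp only: bergman_moment_Beta[OF assms] mult_1_right)
  qed
  show ?thesis
    by (rule that[of "pi * c" "pi * C"]) (auto simp: m cC intro!: ennreal_leI mult_right_mono mult_left_mono)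
qed

section \<open>Composition operators on weighted Bergman spaces\<close>

lemma Moebius_denominator:
  assumes "cmod b < 1" "cmod z < 1"
  shows "1 - cnj b * z \<noteq> 0"
proof
  assume "1 - cnj b * z = 0"
  hence "cmod (cnj b * z) = 1" by simp
  moreover have "cmod (cnj b * z) < 1" using norm_mult_less[of "cnj b" 1 z 1] assms by simp
  ultimately show False by simp
qed

lemma Moebius_deriv:
  assumes b: "cmod b < 1" and z: "cmod z < 1"
  shows "deriv (Moebius_function 0 b) z = (1 - (cmod b)\<^sup>2) / (1 - cnj b * z)\<^sup>2"
proof -
  note nz = Moebius_denominator[OF b z]
  have "((\<lambda>z. (z - b) / (1 - cnj b * z)) has_field_derivative
      ((1 * (1 - cnj b * z) - (z - b) * (0 - cnj b)) / ((1 - cnj b * z) * (1 - cnj b * z)))) (at z)"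
    using nz by (intro DERIV_divide) (auto intro!: derivative_eq_intros)
  moreover have "1 * (1 - cnj b * z) - (z - b) * (0 - cnj b) = 1 - of_real ((cmod b)\<^sup>2)"
    using complex_norm_square[of b] by (simp add: algebra_simps)
  ultimately have "((\<lambda>z. (z - b) / (1 - cnj b * z)) has_field_derivative
      ((1 - of_real ((cmod b)\<^sup>2)) / ((1 - cnj b * z) * (1 - cnj b * z)))) (at z)"
    by (simp only:)
  from DERIV_imp_deriv[OF this] show ?thesis
    unfolding Moebius_function_simple by (simp add: power2_eq_square)
qed

lemma Moebius_norm_deriv:
  assumes b: "cmod b < 1" and z: "cmod z < 1"
  shows "cmod (deriv (Moebius_function 0 b) z) = (1 - (cmod b)\<^sup>2) / (cmod (1 - cnj b * z))\<^sup>2"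
proof -
  have "(cmod b)\<^sup>2 \<le> 1" using b by (simp add: power_le_one)
  hence "cmod (1 - (complex_of_real (cmod b))\<^sup>2) = 1 - (cmod b)\<^sup>2"
    using norm_of_real[of "1 - (cmod b)\<^sup>2", where 'a=complex] by simp
  thus ?thesis unfolding Moebius_deriv[OF b z] by (simp add: norm_divide norm_power)
qed

text \<open>
  Disc automorphisms are isometries of the hyperbolic metric: equality in the Schwarz-Pick lemma.
\<close>

lemma Moebius_norm:
  assumes b: "cmod b < 1" and z: "cmod z < 1"
  shows "1 - (cmod (Moebius_function 0 b z))\<^sup>2 = (1 - (cmod z)\<^sup>2) * cmod (deriv (Moebius_function 0 b) z)"
proof -
  note nz = Moebius_denominator[OF b z]
  \<comment> \<open>The classical identity behind all computations with disc automorphisms.\<close>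
  have id: "(cmod (1 - cnj b * z))\<^sup>2 - (cmod (z - b))\<^sup>2 = (1 - (cmod b)\<^sup>2) * (1 - (cmod z)\<^sup>2)"
    unfolding cmod_power2 by (simp add: power2_eq_square algebra_simps)
  have "1 - (cmod (Moebius_function 0 b z))\<^sup>2
      = ((cmod (1 - cnj b * z))\<^sup>2 - (cmod (z - b))\<^sup>2) / (cmod (1 - cnj b * z))\<^sup>2"
    unfolding Moebius_function_simple norm_divide power_divide using nz by (simp add: field_simps)
  thus ?thesis by (simp add: id Moebius_norm_deriv[OF b z])
qed

lemma Moebius_deriv_lower:
  assumes b: "cmod b < 1" and z: "cmod z < 1"
  shows "(1 - (cmod b)\<^sup>2) / 4 \<le> cmod (deriv (Moebius_function 0 b) z)"
proof -
  note nz = Moebius_denominator[OF b z]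
  have b1: "(cmod b)\<^sup>2 \<le> 1" using b by (simp add: power_le_one)
  have "cmod (1 - cnj b * z) \<le> 1 + cmod (cnj b * z)" using norm_triangle_ineq4[of 1 "cnj b * z"] by simp
  moreover have "cmod (cnj b * z) < 1" using norm_mult_less[of "cnj b" 1 z 1] b z by simp
  ultimately have "(cmod (1 - cnj b * z))\<^sup>2 \<le> 2\<^sup>2" by (intro power_mono) auto
  thus ?thesis unfolding Moebius_norm_deriv[OF b z] using b1 nz by (intro divide_left_mono) auto
qed

lemma measurable_disc_indicator:
  fixes u :: "complex \<Rightarrow> real"
  assumes "continuous_on (ball 0 1) u"
  shows "(\<lambda>z. indicator (ball 0 1) z * ennreal (u z)) \<in> borel_measurable borel"
proof -
  note [measurable] = measurable_disc_function[OF assms]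
  have "(\<lambda>z. indicator (ball 0 1) z * ennreal (if z \<in> ball 0 1 then u z else 0)) \<in> borel_measurable borel"
    by measurable
  also have "(\<lambda>z. indicator (ball 0 1) z * ennreal (if z \<in> ball 0 1 then u z else 0)) = (\<lambda>z. indicator (ball 0 1) z * ennreal (u z))"
    by (auto simp: indicator_def)
  finally show ?thesis .
qed

lemma continuous_disc_weight:
  "continuous_on (ball 0 1) (\<lambda>z::complex. (1 - (cmod z)\<^sup>2) powr \<beta>)"
proof (intro continuous_intros ballI)
  fix z :: complex assume "z \<in> ball 0 1"
  hence "(cmod z)\<^sup>2 < 1" by (simp add: power2_less_imp_less abs_square_less_1)
  thus "1 - (cmod z)\<^sup>2 \<noteq> 0" by simp
qed

text \<open>
  Change of variables for a univalent self-map; enlarging the image to the whole disc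
  gives an inequality.
\<close>

lemma nn_integral_univalent_disc_le:
  fixes u :: "complex \<Rightarrow> real"
  assumes hol: "f holomorphic_on ball 0 1" and inj: "inj_on f (ball 0 1)" and self: "f ` ball 0 1 \<subseteq> ball 0 1"
    and u: "continuous_on (ball 0 1) u"
  shows "(\<integral>\<^sup>+z. indicator (ball 0 1) z * ennreal ((cmod (deriv f z))\<^sup>2 * u (f z)) \<partial>lborel)
     \<le> (\<integral>\<^sup>+w. indicator (ball 0 1) w * ennreal (u w) \<partial>lborel)"
proof -
  let ?G = "\<lambda>w. indicator (ball 0 1) w * ennreal (u w)"
  have bd: "bounded (f ` ball 0 1)" using self bounded_ball bounded_subset by blast
  have "(\<integral>\<^sup>+z. indicator (ball 0 1) z * ennreal ((cmod (deriv f z))\<^sup>2 * u (f z)) \<partial>lborel)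
    = (\<integral>\<^sup>+z. indicator (ball 0 1) z * (ennreal ((cmod (deriv f z))\<^sup>2) * ?G (f z)) \<partial>lborel)"
    using self by (intro nn_integral_cong) (auto simp: indicator_def ennreal_mult' image_subset_iff)
  also have "\<dots> = (\<integral>\<^sup>+w. indicator (f ` ball 0 1) w * ?G w \<partial>lborel)"
    by (rule nn_integral_univalent_image[OF hol _ inj bd measurable_disc_indicator[OF u]]) simp
  also have "\<dots> \<le> (\<integral>\<^sup>+w. ?G w \<partial>lborel)"
    by (intro nn_integral_mono) (auto simp: indicator_def)
  finally show ?thesis .
qed

text \<open>
  After the change of variables \<open>w = \<tau>(z)\<close> the weight is multiplied by \<open>\<bar>\<tau>'\<bar>\<close> to the power \<open>-(\<beta> + 2)\<close>, and \<open>\<bar>\<tau>'\<bar>\<close> is bounded below.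
\<close>

lemma bergman_integral_Moebius:
  assumes b: "cmod b < 1" and \<beta>: "\<beta> > -1" and g: "g holomorphic_on ball 0 1"
  shows "bergman_integral \<beta> (\<lambda>z. g (Moebius_function 0 b z))
     \<le> ennreal (((1 - (cmod b)\<^sup>2) / 4) powr (-(\<beta>+2))) * bergman_integral \<beta> g"
proof -
  let ?\<tau> = "Moebius_function 0 b"
  let ?K = "((1 - (cmod b)\<^sup>2) / 4) powr (-(\<beta>+2))"
  let ?u = "\<lambda>w. (cmod (g w))\<^sup>2 * (1 - (cmod w)\<^sup>2) powr \<beta>"
  have hol: "?\<tau> holomorphic_on ball 0 1" by (rule Moebius_function_holomorphic[OF b])
  have self: "?\<tau> ` ball 0 1 \<subseteq> ball 0 1" using Moebius_function_norm_lt_1[OF b] by auto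
  have inj: "inj_on ?\<tau> (ball 0 1)"
  proof (rule inj_on_inverseI)
    fix z :: complex assume "z \<in> ball 0 1"
    thus "Moebius_function 0 (-b) (?\<tau> z) = z" using b by (intro Moebius_function_compose) auto
  qed
  have u: "continuous_on (ball 0 1) ?u"
    by (intro continuous_on_mult continuous_disc_weight) (intro continuous_intros holomorphic_on_imp_continuous_on g)
  have b1: "(cmod b)\<^sup>2 < 1" using b by (simp add: abs_square_less_1)
  have pt: "(cmod (g (?\<tau> z)))\<^sup>2 * (1 - (cmod z)\<^sup>2) powr \<beta> \<le> ?K * ((cmod (deriv ?\<tau> z))\<^sup>2 * ?u (?\<tau> z))" if z: "cmod z < 1" for z
  proof -
    define d where "d = cmod (deriv ?\<tau> z)"
    have d: "(1 - (cmod b)\<^sup>2) / 4 \<le> d" unfolding d_def by (rule Moebius_deriv_lower[OF b z])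
    have dpos: "d > 0" using d b1 by simp
    have z1: "(cmod z)\<^sup>2 < 1" using z by (simp add: abs_square_less_1)
    have "(1 - (cmod (?\<tau> z))\<^sup>2) powr \<beta> = (1 - (cmod z)\<^sup>2) powr \<beta> * d powr \<beta>"
      unfolding Moebius_norm[OF b z] d_def[symmetric] by (rule powr_mult)
    hence "d\<^sup>2 * (1 - (cmod (?\<tau> z))\<^sup>2) powr \<beta> = (1 - (cmod z)\<^sup>2) powr \<beta> * d powr (\<beta>+2)"
      using dpos by (simp add: powr_add powr_numeral)
    moreover have "1 \<le> ?K * d powr (\<beta>+2)"
    proof -
      have "((1 - (cmod b)\<^sup>2) / 4) powr (\<beta>+2) \<le> d powr (\<beta>+2)"
        using d b1 \<beta> by (intro powr_mono2) auto
      moreover have "((1 - (cmod b)\<^sup>2) / 4) powr (\<beta>+2) > 0" using b1 by simp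
      ultimately show ?thesis unfolding powr_minus by (simp add: field_simps)
    qed
    ultimately have "(1 - (cmod z)\<^sup>2) powr \<beta> \<le> ?K * (d\<^sup>2 * (1 - (cmod (?\<tau> z))\<^sup>2) powr \<beta>)"
      using mult_left_mono[of 1 "?K * d powr (\<beta>+2)" "(1 - (cmod z)\<^sup>2) powr \<beta>"] by (simp add: mult_ac)
    from mult_left_mono[OF this, of "(cmod (g (?\<tau> z)))\<^sup>2"] show ?thesis
      by (simp add: d_def mult_ac)
  qed
  have "bergman_integral \<beta> (\<lambda>z. g (?\<tau> z)) \<le>
    (\<integral>\<^sup>+z. ennreal ?K * (indicator (ball 0 1) z * ennreal ((cmod (deriv ?\<tau> z))\<^sup>2 * ?u (?\<tau> z))) \<partial>lborel)"
    unfolding bergman_integral_def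
  proof (intro nn_integral_mono)
    fix z
    show "indicator (ball 0 1) z * ennreal ((cmod (g (?\<tau> z)))\<^sup>2 * (1 - (cmod z)\<^sup>2) powr \<beta>)
      \<le> ennreal ?K * (indicator (ball 0 1) z * ennreal ((cmod (deriv ?\<tau> z))\<^sup>2 * ?u (?\<tau> z)))"
      using pt[of z] by (cases "cmod z < 1") (auto intro!: ennreal_leI simp: ennreal_mult'[symmetric])
  qed
  also have "\<dots> = ennreal ?K * (\<integral>\<^sup>+z. indicator (ball 0 1) z * ennreal ((cmod (deriv ?\<tau> z))\<^sup>2 * ?u (?\<tau> z)) \<partial>lborel)"
  proof (rule nn_integral_cmult)
    have "continuous_on (ball 0 1) (\<lambda>z. (cmod (deriv ?\<tau> z))\<^sup>2)"
      by (intro continuous_on_power continuous_on_norm holomorphic_on_imp_continuous_on holomorphic_deriv hol open_ball)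
    moreover have "continuous_on (ball 0 1) (\<lambda>z. ?u (?\<tau> z))"
      by (rule continuous_on_compose2[OF u holomorphic_on_imp_continuous_on[OF hol] self])
    ultimately have "continuous_on (ball 0 1) (\<lambda>z. (cmod (deriv ?\<tau> z))\<^sup>2 * ?u (?\<tau> z))"
      by (rule continuous_on_mult)
    thus "(\<lambda>z. indicator (ball 0 1) z * ennreal ((cmod (deriv ?\<tau> z))\<^sup>2 * ?u (?\<tau> z))) \<in> borel_measurable lborel"
      by (simp add: measurable_disc_indicator)
  qed
  also have "\<dots> \<le> ennreal ?K * bergman_integral \<beta> g"
    unfolding bergman_integral_def
    by (intro mult_left_mono nn_integral_univalent_disc_le hol inj self u) auto
  finally show ?thesis .
qed

text \<open>
  Composition operators are bounded on weighted Bergman spaces: a Moebius transformation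
  moves \<open>\<phi> 0\<close> to the origin, where Littlewood's principle applies, and is undone afterwards at
  the price of a constant.
\<close>

lemma bergman_integral_self_map:
  assumes \<phi>: "holo_self_map \<phi>" and \<beta>: "\<beta> > -1"
  obtains K where "K > 0" "\<And>f. f holomorphic_on ball 0 1 \<Longrightarrow>
    bergman_integral \<beta> (\<lambda>z. f (\<phi> z)) \<le> ennreal K * bergman_integral \<beta> f"
proof -
  define a where "a = \<phi> 0"
  have hol: "\<phi> holomorphic_on ball 0 1" and self: "\<And>z. cmod z < 1 \<Longrightarrow> cmod (\<phi> z) < 1"
    using \<phi> by (auto simp: holo_self_map_def image_subset_iff)
  have a: "cmod a < 1" unfolding a_def by (rule self) simp
  have na: "cmod (-a) < 1" using a by simp
  define \<phi>0 where "\<phi>0 = (\<lambda>z. Moebius_function 0 a (\<phi> z))"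
  have hol0: "\<phi>0 holomorphic_on ball 0 1" unfolding \<phi>0_def
    using holomorphic_on_compose_gen[OF hol Moebius_function_holomorphic[OF a, of 0]] self by (simp add: o_def image_subset_iff)
  have self0: "cmod (\<phi>0 z) < 1" if "cmod z < 1" for z
    unfolding \<phi>0_def by (intro Moebius_function_norm_lt_1 a self that)
  have zero: "\<phi>0 0 = 0" by (simp add: \<phi>0_def a_def Moebius_function_eq_zero)
  have inverse: "Moebius_function 0 (-a) (\<phi>0 z) = \<phi> z" if "cmod z < 1" for z
    unfolding \<phi>0_def using a self[OF that] by (intro Moebius_function_compose) auto
  define K where "K = ((1 - (cmod (-a))\<^sup>2) / 4) powr (-(\<beta>+2))"
  have "(cmod a)\<^sup>2 < 1" using a by (simp add: abs_square_less_1)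
  hence "K > 0" by (simp add: K_def)
  moreover have "bergman_integral \<beta> (\<lambda>z. f (\<phi> z)) \<le> ennreal K * bergman_integral \<beta> f" if f: "f holomorphic_on ball 0 1" for f
  proof -
    define g where "g = (\<lambda>z. f (Moebius_function 0 (-a) z))"
    have g: "g holomorphic_on ball 0 1" unfolding g_def
      using holomorphic_on_compose_gen[OF Moebius_function_holomorphic[OF na, of 0] f] Moebius_function_norm_lt_1[OF na]
      by (simp add: o_def image_subset_iff)
    have "bergman_integral \<beta> (\<lambda>z. f (\<phi> z)) = bergman_integral \<beta> (\<lambda>z. g (\<phi>0 z))"
      unfolding bergman_integral_def by (intro nn_integral_cong) (auto simp: indicator_def g_def inverse)
    also have "\<dots> \<le> bergman_integral \<beta> g"
      by (rule bergman_integral_subordinate[OF g hol0 zero self0])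
    also have "\<dots> \<le> ennreal K * bergman_integral \<beta> f"
      unfolding g_def K_def by (rule bergman_integral_Moebius[OF na \<beta> f])
    finally show ?thesis .
  qed
  ultimately show ?thesis using that by blast
qed

section \<open>The Dirichlet norm through Bergman integrals of derivatives\<close>

text \<open>
  The squared Dirichlet norm, with value infinity for holomorphic functions outside the space, so that
  estimates need no prior membership.
\<close>

definition dirichlet_energy :: "real \<Rightarrow> (complex \<Rightarrow> complex) \<Rightarrow> ennreal" where
  "dirichlet_energy \<alpha> f = (\<Sum>n. ennreal (dirichlet_term \<alpha> f n))"

lemma dirichlet_term_taylor:
  "dirichlet_term \<alpha> f n = (real n + 1) powr (1 - \<alpha>) * (cmod (taylor_coeff f n))\<^sup>2"
  by (simp add: dirichlet_term_def taylor_coeff_def fps_expansion_def)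

lemma dirichlet_term_nonneg [simp]: "0 \<le> dirichlet_term \<alpha> f n"
  by (simp add: dirichlet_term_def)

lemma taylor_coeff_deriv: "taylor_coeff (deriv f) n = of_nat (Suc n) * taylor_coeff f (Suc n)"
proof -
  have "(deriv ^^ n) (deriv f) = (deriv ^^ Suc n) f" by (simp add: funpow_swap1)
  thus ?thesis by (simp add: taylor_coeff_def field_simps del: funpow.simps of_nat_Suc)
qed

lemma dirichlet_space_iff_energy:
  "f \<in> dirichlet_space \<alpha> \<longleftrightarrow> f holomorphic_on ball 0 1 \<and> dirichlet_energy \<alpha> f < \<infinity>"
proof -
  have "summable (dirichlet_term \<alpha> f) \<longleftrightarrow> dirichlet_energy \<alpha> f < \<infinity>"
  proof
    assume s: "summable (dirichlet_term \<alpha> f)"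
    thus "dirichlet_energy \<alpha> f < \<infinity>" unfolding dirichlet_energy_def by (subst suminf_ennreal2) auto
  next
    assume "dirichlet_energy \<alpha> f < \<infinity>"
    thus "summable (dirichlet_term \<alpha> f)" unfolding dirichlet_energy_def
      by (intro summable_suminf_not_top) auto
  qed
  thus ?thesis by (simp add: dirichlet_space_def)
qed

lemma dirichlet_energy_eq_norm:
  assumes "f \<in> dirichlet_space \<alpha>"
  shows "dirichlet_energy \<alpha> f = ennreal ((dirichlet_norm \<alpha> f)\<^sup>2)"
  using assms unfolding dirichlet_energy_def dirichlet_norm_def dirichlet_space_def
  by (subst suminf_ennreal2) (auto simp: suminf_nonneg)

lemma dirichlet_norm_nonneg: 
  assumes "f \<in> dirichlet_space \<alpha>"
  shows "0 \<le> dirichlet_norm \<alpha> f"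
  using assms unfolding dirichlet_norm_def dirichlet_space_def by (auto simp: suminf_nonneg)

lemma dirichlet_energy_le_square:
  assumes "f \<in> dirichlet_space \<alpha>" "dirichlet_norm \<alpha> f \<le> B"
  shows "dirichlet_energy \<alpha> f \<le> ennreal (B\<^sup>2)"
  unfolding dirichlet_energy_eq_norm[OF assms(1)]
  using assms by (intro ennreal_leI power_mono dirichlet_norm_nonneg)

lemma suminf_ennreal_shift_le:
  fixes f :: "nat \<Rightarrow> ennreal"
  shows "(\<Sum>n. f (n + k)) \<le> (\<Sum>n. f n)"
proof (rule suminf_le_const)
  fix m
  have "(\<Sum>n<m. f (n + k)) = sum f {k..<m+k}"
    by (metis atLeast0LessThan add_0 sum.shift_bounds_nat_ivl)
  also have "\<dots> \<le> sum f {..<m+k}" by (rule sum_mono2) auto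
  also have "\<dots> \<le> (\<Sum>n. f n)" by (rule sum_le_suminf) auto
  finally show "(\<Sum>n<m. f (n + k)) \<le> (\<Sum>n. f n)" .
qed auto

lemma suminf_ennreal_le_split:
  fixes f :: "nat \<Rightarrow> ennreal"
  shows "(\<Sum>n. f n) \<le> (\<Sum>n<k. f n) + (\<Sum>n. f (n + k))"
proof (rule suminf_le_const)
  fix m
  have "(\<Sum>n<m. f n) \<le> (\<Sum>n<m+k. f n)" by (rule sum_mono2) auto
  also have "{..<m+k} = {..<k} \<union> {k..<m+k}" by auto
  also have "sum f \<dots> = (\<Sum>n<k. f n) + sum f {k..<m+k}" by (rule sum.union_disjoint) auto
  also have "sum f {k..<m+k} = (\<Sum>n<m. f (n + k))"
    by (metis atLeast0LessThan add_0 sum.shift_bounds_nat_ivl)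
  also have "(\<Sum>n<m. f (n + k)) \<le> (\<Sum>n. f (n + k))" by (rule sum_le_suminf) auto
  finally show "(\<Sum>n<m. f n) \<le> (\<Sum>n<k. f n) + (\<Sum>n. f (n + k))" by simp
qed auto

lemma bergman_integral_le_sum:
  assumes "\<beta> > -1"
  obtains C where "C > 0" "\<And>f. f holomorphic_on ball 0 1 \<Longrightarrow>
    bergman_integral \<beta> f \<le> ennreal C * (\<Sum>n. ennreal ((cmod (taylor_coeff f n))\<^sup>2 * (real n + 1) powr (-(\<beta>+1))))"
proof -
  obtain c C where C: "0 < C" "\<And>n. bergman_moment \<beta> n \<le> ennreal (C * (real n + 1) powr (-(\<beta>+1)))"
    using bergman_moment_bounds[OF assms] by metis
  show ?thesis
  proof (rule that[OF C(1)])
    fix f assume f: "f holomorphic_on ball 0 1"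
    have "bergman_integral \<beta> f \<le> (\<Sum>n. ennreal C * ennreal ((cmod (taylor_coeff f n))\<^sup>2 * (real n + 1) powr (-(\<beta>+1))))"
      unfolding bergman_integral_coeffs[OF f]
    proof (intro suminf_le allI summableI)
      fix n
      have "ennreal ((cmod (taylor_coeff f n))\<^sup>2) * bergman_moment \<beta> n \<le> ennreal ((cmod (taylor_coeff f n))\<^sup>2) * ennreal (C * (real n + 1) powr (-(\<beta>+1)))"
        by (intro mult_left_mono C) auto
      also have "\<dots> = ennreal C * ennreal ((cmod (taylor_coeff f n))\<^sup>2 * (real n + 1) powr (-(\<beta>+1)))"
        using C(1) by (simp add: ennreal_mult[symmetric] mult_ac)
      finally show "ennreal ((cmod (taylor_coeff f n))\<^sup>2) * bergman_moment \<beta> n \<le> \<dots>" .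
    qed
    thus "bergman_integral \<beta> f \<le> ennreal C * (\<Sum>n. ennreal ((cmod (taylor_coeff f n))\<^sup>2 * (real n + 1) powr (-(\<beta>+1))))"
      by (simp add: ennreal_suminf_cmult)
  qed
qed

lemma bergman_integral_ge_sum:
  assumes "\<beta> > -1"
  obtains K where "K > 0" "\<And>f. f holomorphic_on ball 0 1 \<Longrightarrow>
    (\<Sum>n. ennreal ((cmod (taylor_coeff f n))\<^sup>2 * (real n + 1) powr (-(\<beta>+1)))) \<le> ennreal K * bergman_integral \<beta> f"
proof -
  obtain c C where c: "0 < c" "\<And>n. ennreal (c * (real n + 1) powr (-(\<beta>+1))) \<le> bergman_moment \<beta> n"
    using bergman_moment_bounds[OF assms] by metis
  show ?thesis
  proof (rule that[of "inverse c"])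
    fix f assume f: "f holomorphic_on ball 0 1"
    have "(\<Sum>n. ennreal ((cmod (taylor_coeff f n))\<^sup>2 * (real n + 1) powr (-(\<beta>+1)))) \<le>
       (\<Sum>n. ennreal (inverse c) * (ennreal ((cmod (taylor_coeff f n))\<^sup>2) * bergman_moment \<beta> n))"
    proof (intro suminf_le allI summableI)
      fix n
      have "ennreal ((cmod (taylor_coeff f n))\<^sup>2 * (real n + 1) powr (-(\<beta>+1))) 
        = ennreal (inverse c) * (ennreal ((cmod (taylor_coeff f n))\<^sup>2) * ennreal (c * (real n + 1) powr (-(\<beta>+1))))"
        using c(1) by (simp add: ennreal_mult[symmetric] field_simps)
      also have "\<dots> \<le> ennreal (inverse c) * (ennreal ((cmod (taylor_coeff f n))\<^sup>2) * bergman_moment \<beta> n)"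
        by (intro mult_left_mono c) auto
      finally show "ennreal ((cmod (taylor_coeff f n))\<^sup>2 * (real n + 1) powr (-(\<beta>+1))) \<le> \<dots>" .
    qed
    thus "(\<Sum>n. ennreal ((cmod (taylor_coeff f n))\<^sup>2 * (real n + 1) powr (-(\<beta>+1)))) \<le> ennreal (inverse c) * bergman_integral \<beta> f"
      by (simp add: ennreal_suminf_cmult bergman_integral_coeffs[OF f])
  qed (use c in simp)
qed

text \<open>
  A common form of the three embeddings below. The shift \<open>k\<close> is the order of the derivative, which moves
  the coefficient of index \<open>n + k\<close> to index \<open>n\<close>.
\<close>

lemma bergman_integral_le_energy_if_coeff_le:
  assumes "\<beta> > -1"
  obtains C where "C > 0" "\<And>F f D k \<alpha>. F holomorphic_on ball 0 1 \<Longrightarrow> 0 \<le> D \<Longrightarrow>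
      (\<And>n. (cmod (taylor_coeff F n))\<^sup>2 * (real n + 1) powr (-(\<beta>+1)) \<le> D * dirichlet_term \<alpha> f (n + k)) \<Longrightarrow>
      bergman_integral \<beta> F \<le> ennreal (C * D) * dirichlet_energy \<alpha> f"
proof -
  obtain C where C: "C > 0" "\<And>f. f holomorphic_on ball 0 1 \<Longrightarrow>
    bergman_integral \<beta> f \<le> ennreal C * (\<Sum>n. ennreal ((cmod (taylor_coeff f n))\<^sup>2 * (real n + 1) powr (-(\<beta>+1))))"
    using bergman_integral_le_sum[OF assms] by metis
  show ?thesis
  proof (rule that[OF C(1)])
    fix F f D k \<alpha>
    assume F: "F holomorphic_on ball 0 1" and D: "0 \<le> D"
      and le: "\<And>n. (cmod (taylor_coeff F n))\<^sup>2 * (real n + 1) powr (-(\<beta>+1)) \<le> D * dirichlet_term \<alpha> f (n + k)"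
    have "(\<Sum>n. ennreal ((cmod (taylor_coeff F n))\<^sup>2 * (real n + 1) powr (-(\<beta>+1)))) \<le> (\<Sum>n. ennreal D * ennreal (dirichlet_term \<alpha> f (n + k)))"
      using D by (intro suminf_le allI summableI) (subst ennreal_mult'[symmetric], simp, rule ennreal_leI, rule le)
    also have "\<dots> = ennreal D * (\<Sum>n. ennreal (dirichlet_term \<alpha> f (n + k)))" by (rule ennreal_suminf_cmult)
    also have "\<dots> \<le> ennreal D * dirichlet_energy \<alpha> f"
      unfolding dirichlet_energy_def by (intro mult_left_mono suminf_ennreal_shift_le) auto
    finally have S: "(\<Sum>n. ennreal ((cmod (taylor_coeff F n))\<^sup>2 * (real n + 1) powr (-(\<beta>+1)))) \<le> ennreal D * dirichlet_energy \<alpha> f" .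
    have "bergman_integral \<beta> F \<le> ennreal C * (ennreal D * dirichlet_energy \<alpha> f)"
      by (rule order_trans[OF C(2)[OF F] mult_left_mono[OF S]]) simp
    thus "bergman_integral \<beta> F \<le> ennreal (C * D) * dirichlet_energy \<alpha> f"
      using C(1) D by (simp add: ennreal_mult mult.assoc)
  qed
qed

lemma bergman_integral_le_energy:
  assumes "\<alpha> > -1"
  obtains C where "C > 0" "\<And>f. f holomorphic_on ball 0 1 \<Longrightarrow> bergman_integral \<alpha> f \<le> ennreal C * dirichlet_energy \<alpha> f"
proof -
  obtain C where C: "C > 0" "\<And>F f D k \<alpha>'. F holomorphic_on ball 0 1 \<Longrightarrow> 0 \<le> D \<Longrightarrow>
      (\<And>n. (cmod (taylor_coeff F n))\<^sup>2 * (real n + 1) powr (-(\<alpha>+1)) \<le> D * dirichlet_term \<alpha>' f (n + k)) \<Longrightarrow>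
      bergman_integral \<alpha> F \<le> ennreal (C * D) * dirichlet_energy \<alpha>' f"
    using bergman_integral_le_energy_if_coeff_le[OF assms] by metis
  show ?thesis
  proof (rule that[OF C(1)])
    fix f assume f: "f holomorphic_on ball 0 1"
    have "(cmod (taylor_coeff f n))\<^sup>2 * (real n + 1) powr (-(\<alpha>+1)) \<le> 1 * dirichlet_term \<alpha> f (n + 0)" for n
    proof -
      have "(cmod (taylor_coeff f n))\<^sup>2 * (real n + 1) powr (-(\<alpha>+1)) \<le> (cmod (taylor_coeff f n))\<^sup>2 * (real n + 1) powr (1 - \<alpha>)"
        by (intro mult_left_mono powr_mono) auto
      thus ?thesis unfolding dirichlet_term_taylor by (simp only: mult.commute mult_1_left add_0_right)
    qed
    from C(2)[OF f _ this] show "bergman_integral \<alpha> f \<le> ennreal C * dirichlet_energy \<alpha> f" by simp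
  qed
qed

lemma bergman_integral_deriv_le_energy:
  assumes "-1 < \<alpha>" "\<alpha> < 1"
  obtains C where "C > 0" "\<And>f. f holomorphic_on ball 0 1 \<Longrightarrow> bergman_integral \<alpha> (deriv f) \<le> ennreal C * dirichlet_energy \<alpha> f"
proof -
  obtain C where C: "C > 0" "\<And>F f D k \<alpha>'. F holomorphic_on ball 0 1 \<Longrightarrow> 0 \<le> D \<Longrightarrow>
      (\<And>n. (cmod (taylor_coeff F n))\<^sup>2 * (real n + 1) powr (-(\<alpha>+1)) \<le> D * dirichlet_term \<alpha>' f (n + k)) \<Longrightarrow>
      bergman_integral \<alpha> F \<le> ennreal (C * D) * dirichlet_energy \<alpha>' f"
    using bergman_integral_le_energy_if_coeff_le[OF assms(1)] by metis
  show ?thesis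
  proof (rule that[OF C(1)])
    fix f assume f: "f holomorphic_on ball 0 1"
    have "(cmod (taylor_coeff (deriv f) n))\<^sup>2 * (real n + 1) powr (-(\<alpha>+1)) \<le> 1 * dirichlet_term \<alpha> f (n + 1)" for n
    proof -
      let ?a = "(cmod (taylor_coeff f (n+1)))\<^sup>2"
      have "(real n + 1)\<^sup>2 * (real n + 1) powr (-(\<alpha>+1)) = (real n + 1) powr (2 + -(\<alpha>+1))"
        unfolding powr_add by (simp add: powr_numeral)
      also have "2 + -(\<alpha>+1) = 1 - \<alpha>" by simp
      also have "(real n + 1) powr (1 - \<alpha>) \<le> (real (n + 1) + 1) powr (1 - \<alpha>)" using assms by (intro powr_mono2) auto
      finally have "?a * ((real n + 1)\<^sup>2 * (real n + 1) powr (-(\<alpha>+1))) \<le> ?a * (real (n + 1) + 1) powr (1 - \<alpha>)"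
        by (intro mult_left_mono) auto
      moreover have "(cmod (taylor_coeff (deriv f) n))\<^sup>2 = (real n + 1)\<^sup>2 * ?a"
        unfolding taylor_coeff_deriv norm_mult norm_of_nat power_mult_distrib by (simp add: add.commute)
      ultimately show ?thesis
        unfolding dirichlet_term_taylor by (simp only: mult_ac mult_1_left)
    qed
    from C(2)[OF holomorphic_deriv[OF f open_ball] _ this]
    show "bergman_integral \<alpha> (deriv f) \<le> ennreal C * dirichlet_energy \<alpha> f" by simp
  qed
qed

lemma taylor_coeff_deriv2:
  "(cmod (taylor_coeff (deriv (deriv f)) n))\<^sup>2 = ((real n + 1)\<^sup>2 * (real n + 2)\<^sup>2) * (cmod (taylor_coeff f (n+2)))\<^sup>2"
  unfolding taylor_coeff_deriv norm_mult norm_of_nat power_mult_distrib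
  by (simp add: add.commute)

text \<open>
  Two derivatives multiply the squared coefficient of index \<open>n + 2\<close> by about \<open>n\<^sup>4\<close>, and the moment of
  exponent \<open>\<alpha> + 2\<close> contributes \<open>n\<close> to the power \<open>-(\<alpha> + 3)\<close>; what remains is the weight \<open>1 - \<alpha>\<close> of the Dirichlet norm.
\<close>

lemma bergman_integral_deriv2_le_energy:
  assumes "-1 < \<alpha>" "\<alpha> < 1"
  obtains C where "C > 0" "\<And>f. f holomorphic_on ball 0 1 \<Longrightarrow> bergman_integral (\<alpha>+2) (deriv (deriv f)) \<le> ennreal C * dirichlet_energy \<alpha> f"
proof -
  have "\<alpha> + 2 > -1" using assms by simp
  from bergman_integral_le_energy_if_coeff_le[OF this]
  obtain C where C: "C > 0" "\<And>F f D k \<alpha>'. F holomorphic_on ball 0 1 \<Longrightarrow> 0 \<le> D \<Longrightarrow>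
      (\<And>n. (cmod (taylor_coeff F n))\<^sup>2 * (real n + 1) powr (-(\<alpha>+2+1)) \<le> D * dirichlet_term \<alpha>' f (n + k)) \<Longrightarrow>
      bergman_integral (\<alpha>+2) F \<le> ennreal (C * D) * dirichlet_energy \<alpha>' f"
    by metis
  show ?thesis
  proof (rule that[of "C * 4"])
    fix f assume f: "f holomorphic_on ball 0 1"
    have "(cmod (taylor_coeff (deriv (deriv f)) n))\<^sup>2 * (real n + 1) powr (-(\<alpha>+2+1)) \<le> 4 * dirichlet_term \<alpha> f (n + 2)" for n
    proof -
      let ?a = "(cmod (taylor_coeff f (n+2)))\<^sup>2"
      have "(real n + 1)\<^sup>2 * (real n + 2)\<^sup>2 \<le> (real n + 1)\<^sup>2 * (2 * (real n + 1))\<^sup>2"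
        by (intro mult_left_mono power_mono) auto
      also have "\<dots> = 4 * ((real n + 1)\<^sup>2 * (real n + 1)\<^sup>2)"
        by (simp only: power_mult_distrib) simp
      also have "(real n + 1)\<^sup>2 * (real n + 1)\<^sup>2 = (real n + 1) powr 4"
        by (simp add: powr_numeral flip: power_add)
      finally have "((real n + 1)\<^sup>2 * (real n + 2)\<^sup>2) * (real n + 1) powr (-(\<alpha>+2+1)) \<le> 4 * (real n + 1) powr 4 * (real n + 1) powr (-(\<alpha>+2+1))"
        by (intro mult_right_mono) auto
      also have "\<dots> = 4 * (real n + 1) powr (4 + -(\<alpha>+2+1))"
        unfolding powr_add by (simp only: mult.assoc)
      also have "4 + -(\<alpha>+2+1) = 1 - \<alpha>" by simp
      also have "4 * (real n + 1) powr (1 - \<alpha>) \<le> 4 * (real (n + 2) + 1) powr (1 - \<alpha>)" using assms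
        by (intro mult_left_mono powr_mono2) auto
      finally have "?a * (((real n + 1)\<^sup>2 * (real n + 2)\<^sup>2) * (real n + 1) powr (-(\<alpha>+2+1))) \<le> ?a * (4 * (real (n + 2) + 1) powr (1 - \<alpha>))"
        by (intro mult_left_mono) auto
      thus ?thesis
        unfolding dirichlet_term_taylor taylor_coeff_deriv2 by (simp only: mult_ac)
    qed
    from C(2)[OF holomorphic_deriv[OF holomorphic_deriv[OF f open_ball] open_ball] _ this]
    show "bergman_integral (\<alpha>+2) (deriv (deriv f)) \<le> ennreal (C * 4) * dirichlet_energy \<alpha> f" by simp
  qed (use C in simp)
qed

text \<open>
  The converse embedding. The second derivative forgets the first two coefficients, which therefore
  have to be added.
\<close>

lemma energy_le_bergman_integral:
  assumes "-1 < \<alpha>" "\<alpha> < 1"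
  obtains K where "K > 0" "\<And>F. F holomorphic_on ball 0 1 \<Longrightarrow> dirichlet_energy \<alpha> F \<le>
      ennreal (dirichlet_term \<alpha> F 0) + ennreal (dirichlet_term \<alpha> F 1) + ennreal K * bergman_integral (\<alpha>+2) (deriv (deriv F))"
proof -
  have \<alpha>2: "\<alpha> + 2 > -1" using assms by simp
  obtain K where K: "K > 0" "\<And>f. f holomorphic_on ball 0 1 \<Longrightarrow>
    (\<Sum>n. ennreal ((cmod (taylor_coeff f n))\<^sup>2 * (real n + 1) powr (-(\<alpha>+2+1)))) \<le> ennreal K * bergman_integral (\<alpha>+2) f"
    by (rule bergman_integral_ge_sum[OF \<alpha>2], blast)
  \<comment> \<open>The constant comes from \<open>n + 3 \<le> 3 * (n + 1)\<close>.\<close>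
  let ?D = "3 powr (1 - \<alpha>)"
  show ?thesis
  proof (rule that[of "?D * K"])
    fix F assume F: "F holomorphic_on ball 0 1"
    let ?s = "\<lambda>n. (cmod (taylor_coeff (deriv (deriv F)) n))\<^sup>2 * (real n + 1) powr (-(\<alpha>+2+1))"
    have le: "dirichlet_term \<alpha> F (n + 2) \<le> ?D * ?s n" for n
    proof -
      let ?a = "(cmod (taylor_coeff F (n+2)))\<^sup>2"
      have "(real (n + 2) + 1) powr (1 - \<alpha>) \<le> (3 * (real n + 1)) powr (1 - \<alpha>)"
        using assms by (intro powr_mono2) auto
      also have "\<dots> = ?D * (real n + 1) powr (1 - \<alpha>)" by (rule powr_mult)
      also have "(real n + 1) powr (1 - \<alpha>) = (real n + 1) powr (4 + -(\<alpha>+2+1))" by simp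
      also have "\<dots> = (real n + 1) powr 4 * (real n + 1) powr (-(\<alpha>+2+1))"
        by (rule powr_add)
      also have "(real n + 1) powr 4 = (real n + 1)\<^sup>2 * (real n + 1)\<^sup>2"
        by (simp add: powr_numeral flip: power_add)
      also have "?D * ((real n + 1)\<^sup>2 * (real n + 1)\<^sup>2 * (real n + 1) powr (-(\<alpha>+2+1)))
         \<le> ?D * ((real n + 1)\<^sup>2 * (real n + 2)\<^sup>2 * (real n + 1) powr (-(\<alpha>+2+1)))"
        by (intro mult_left_mono mult_right_mono power_mono) auto
      finally have "?a * (real (n + 2) + 1) powr (1 - \<alpha>) \<le> ?a * (?D * ((real n + 1)\<^sup>2 * (real n + 2)\<^sup>2 * (real n + 1) powr (-(\<alpha>+2+1))))"
        by (rule mult_left_mono) simp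
      thus ?thesis unfolding dirichlet_term_taylor taylor_coeff_deriv2 by (simp only: mult_ac)
    qed
    have "(\<Sum>n. ennreal (dirichlet_term \<alpha> F (n + 2))) \<le> (\<Sum>n. ennreal ?D * ennreal (?s n))"
      by (intro suminf_le allI summableI) (subst ennreal_mult'[symmetric], simp, rule ennreal_leI, rule le)
    also have "(\<Sum>n. ennreal ?D * ennreal (?s n)) = ennreal ?D * (\<Sum>n. ennreal (?s n))" by (rule ennreal_suminf_cmult)
    also have "\<dots> \<le> ennreal ?D * (ennreal K * bergman_integral (\<alpha>+2) (deriv (deriv F)))"
      by (intro mult_left_mono K holomorphic_deriv F open_ball) auto
    also have "\<dots> = ennreal (?D * K) * bergman_integral (\<alpha>+2) (deriv (deriv F))"
      using K(1) by (simp add: ennreal_mult mult.assoc)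
    finally have tail: "(\<Sum>n. ennreal (dirichlet_term \<alpha> F (n + 2))) \<le> ennreal (?D * K) * bergman_integral (\<alpha>+2) (deriv (deriv F))" .
    have "dirichlet_energy \<alpha> F \<le> (\<Sum>n<2. ennreal (dirichlet_term \<alpha> F n)) + (\<Sum>n. ennreal (dirichlet_term \<alpha> F (n + 2)))"
      unfolding dirichlet_energy_def by (rule suminf_ennreal_le_split)
    also have "\<dots> \<le> (\<Sum>n<2. ennreal (dirichlet_term \<alpha> F n)) + ennreal (?D * K) * bergman_integral (\<alpha>+2) (deriv (deriv F))"
      by (intro add_left_mono tail)
    also have "(\<Sum>n<2. ennreal (dirichlet_term \<alpha> F n)) = ennreal (dirichlet_term \<alpha> F 0) + ennreal (dirichlet_term \<alpha> F 1)"
      by (simp add: numeral_2_eq_2)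
    finally show "dirichlet_energy \<alpha> F \<le> ennreal (dirichlet_term \<alpha> F 0) + ennreal (dirichlet_term \<alpha> F 1) + ennreal (?D * K) * bergman_integral (\<alpha>+2) (deriv (deriv F))" .
  qed (use K in simp)
qed

section \<open>The second derivative of a weighted composition near the unit circle\<close>

lemma holo_self_mapD:
  assumes "holo_self_map \<phi>"
  shows "\<phi> holomorphic_on ball 0 1" "\<phi> ` ball 0 1 \<subseteq> ball 0 1" "z \<in> ball 0 1 \<Longrightarrow> \<phi> z \<in> ball 0 1"
  using assms unfolding holo_self_map_def by blast+

lemma holomorphic_self_map_compose:
  assumes "holo_self_map \<phi>" "h holomorphic_on ball 0 1"
  shows "(\<lambda>z. h (\<phi> z)) holomorphic_on ball 0 1"
  using holomorphic_on_compose_gen[of \<phi> "ball 0 1" h "ball 0 1"] assms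
  by (simp add: holo_self_map_def o_def)

lemma holomorphic_wcomp:
  assumes "\<psi> holomorphic_on ball 0 1" "holo_self_map \<phi>" "h holomorphic_on ball 0 1"
  shows "wcomp \<psi> \<phi> h holomorphic_on ball 0 1"
  unfolding wcomp_def by (rule holomorphic_on_mult[OF assms(1) holomorphic_self_map_compose[OF assms(2,3)]])

lemma wcomp_deriv2:
  assumes \<psi>: "\<psi> holomorphic_on ball 0 1" and \<phi>: "holo_self_map \<phi>" and h: "h holomorphic_on ball 0 1"
    and z: "z \<in> ball 0 1"
  shows "deriv (deriv (wcomp \<psi> \<phi> h)) z =
    (deriv ^^ 2) \<psi> z * h (\<phi> z) + 2 * (deriv \<phi> z * deriv \<psi> z) * deriv h (\<phi> z)
    + ((deriv ^^ 2) \<phi> z * \<psi> z) * deriv h (\<phi> z) + (deriv \<phi> z * \<psi> z) * (deriv \<phi> z * deriv (deriv h) (\<phi> z))"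
proof -
  have h\<phi>: "\<phi> holomorphic_on ball 0 1" and self: "\<And>w. w \<in> ball 0 1 \<Longrightarrow> \<phi> w \<in> ball 0 1"
    using holo_self_mapD[OF \<phi>] by blast+
  have D: "(f has_field_derivative deriv f w) (at w)" if "f holomorphic_on ball 0 1" "w \<in> ball 0 1" for f w
    using holomorphic_derivI[OF that(1) open_ball that(2)] .
  have comp: "((\<lambda>w. f (\<phi> w)) has_field_derivative deriv f (\<phi> w) * deriv \<phi> w) (at w)"
    if "f holomorphic_on ball 0 1" "w \<in> ball 0 1" for f w
    using DERIV_chain2[OF D[OF that(1) self[OF that(2)]] D[OF h\<phi> that(2)]] .
  note hol' = holomorphic_deriv[OF _ open_ball]
  define G where "G = (\<lambda>w. deriv \<psi> w * h (\<phi> w) + (deriv h (\<phi> w) * deriv \<phi> w) * \<psi> w)"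
  have first: "deriv (wcomp \<psi> \<phi> h) w = G w" if "w \<in> ball 0 1" for w
    unfolding wcomp_def G_def by (rule DERIV_imp_deriv DERIV_mult D \<psi> comp h that)+
  have "(G has_field_derivative
      (deriv (deriv \<psi>) z * h (\<phi> z) + (deriv h (\<phi> z) * deriv \<phi> z) * deriv \<psi> z) +
      (((deriv (deriv h) (\<phi> z) * deriv \<phi> z) * deriv \<phi> z + deriv (deriv \<phi>) z * deriv h (\<phi> z)) * \<psi> z
        + deriv \<psi> z * (deriv h (\<phi> z) * deriv \<phi> z))) (at z)"
    unfolding G_def by (intro DERIV_add DERIV_mult D comp hol' \<psi> h\<phi> h z)
  hence "(deriv (wcomp \<psi> \<phi> h) has_field_derivative
      (deriv (deriv \<psi>) z * h (\<phi> z) + (deriv h (\<phi> z) * deriv \<phi> z) * deriv \<psi> z) +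
      (((deriv (deriv h) (\<phi> z) * deriv \<phi> z) * deriv \<phi> z + deriv (deriv \<phi>) z * deriv h (\<phi> z)) * \<psi> z
        + deriv \<psi> z * (deriv h (\<phi> z) * deriv \<phi> z))) (at z)"
    by (rule has_field_derivative_transform_within_open[OF _ open_ball z]) (simp add: first)
  from DERIV_imp_deriv[OF this] show ?thesis
    by (simp add: numeral_2_eq_2 algebra_simps)
qed

lemma norm_sum4_square_le:
  fixes a b c d :: complex
  shows "(cmod (a + b + c + d))\<^sup>2 \<le> 4 * ((cmod a)\<^sup>2 + (cmod b)\<^sup>2 + (cmod c)\<^sup>2 + (cmod d)\<^sup>2)"
proof -
  have "cmod (a + b + c + d) \<le> cmod a + cmod b + cmod c + cmod d"
    using norm_triangle_ineq[of "a + b + c" d] norm_triangle_ineq[of "a + b" c] norm_triangle_ineq[of a b] by linarith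
  hence "(cmod (a + b + c + d))\<^sup>2 \<le> (cmod a + cmod b + cmod c + cmod d)\<^sup>2" by (intro power_mono) auto
  also have "\<dots> \<le> 4 * ((cmod a)\<^sup>2 + (cmod b)\<^sup>2 + (cmod c)\<^sup>2 + (cmod d)\<^sup>2)"
  proof -
    have sq: "(x + y + u + v)\<^sup>2 + ((x-y)\<^sup>2 + (x-u)\<^sup>2 + (x-v)\<^sup>2 + (y-u)\<^sup>2 + (y-v)\<^sup>2 + (u-v)\<^sup>2) = 4 * (x\<^sup>2 + y\<^sup>2 + u\<^sup>2 + v\<^sup>2)" for x y u v :: real
      by (simp add: power2_eq_square algebra_simps)
    have nn: "0 \<le> (x-y)\<^sup>2 + (x-u)\<^sup>2 + (x-v)\<^sup>2 + (y-u)\<^sup>2 + (y-v)\<^sup>2 + (u-v)\<^sup>2" for x y u v :: real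
      by (intro add_nonneg_nonneg zero_le_power2)
    show ?thesis using sq[of "cmod a" "cmod b" "cmod c" "cmod d"] nn[of "cmod a" "cmod b" "cmod c" "cmod d"] by linarith
  qed
  finally show ?thesis .
qed

text \<open>
  Each of the four terms of the second derivative carries the factor that one boundary condition makes
  small. In the first three the spare factor \<open>(1 - \<bar>z\<bar>\<^sup>2)\<^sup>2\<close> is absorbed and the weight of exponent \<open>\<alpha>\<close>
  is left; in the last one the weight at \<open>z\<close> is exchanged for the weight at \<open>\<phi> z\<close>, leaving
  \<open>\<bar>\<phi>'\<bar>\<^sup>2\<close> as Jacobian for a change of variables.
\<close>

lemma wcomp_deriv2_pointwise:
  assumes \<psi>: "\<psi> holomorphic_on ball 0 1" and \<phi>: "holo_self_map \<phi>" and h: "h holomorphic_on ball 0 1"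
    and z: "z \<in> ball 0 1" and \<epsilon>: "0 \<le> \<epsilon>"
    and b1: "cmod ((deriv ^^ 2) \<psi> z) * (1 - (cmod z)\<^sup>2) \<le> \<epsilon>"
    and b2: "cmod (deriv \<phi> z * deriv \<psi> z) * (1 - (cmod z)\<^sup>2) \<le> \<epsilon>"
    and b3: "cmod ((deriv ^^ 2) \<phi> z * \<psi> z) * (1 - (cmod z)\<^sup>2) \<le> \<epsilon>"
    and b4: "cmod (deriv \<phi> z * \<psi> z) * ((1 - (cmod z)\<^sup>2) / (1 - (cmod (\<phi> z))\<^sup>2)) powr (\<alpha> / 2 + 1) \<le> \<epsilon>"
  shows "(cmod (deriv (deriv (wcomp \<psi> \<phi> h)) z))\<^sup>2 * (1 - (cmod z)\<^sup>2) powr (\<alpha> + 2)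
    \<le> 4 * \<epsilon>\<^sup>2 * ((cmod (h (\<phi> z)))\<^sup>2 * (1 - (cmod z)\<^sup>2) powr \<alpha>)
      + 20 * \<epsilon>\<^sup>2 * ((cmod (deriv h (\<phi> z)))\<^sup>2 * (1 - (cmod z)\<^sup>2) powr \<alpha>)
      + 4 * \<epsilon>\<^sup>2 * ((cmod (deriv \<phi> z))\<^sup>2 * ((cmod (deriv (deriv h) (\<phi> z)))\<^sup>2 * (1 - (cmod (\<phi> z))\<^sup>2) powr (\<alpha> + 2)))"
proof -
  define s where "s = 1 - (cmod z)\<^sup>2"
  define t where "t = 1 - (cmod (\<phi> z))\<^sup>2"
  have s: "s > 0" using z by (simp add: s_def abs_square_less_1)
  have "\<phi> z \<in> ball 0 1" by (rule holo_self_mapD[OF \<phi>]) (rule z)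
  hence t: "t > 0" by (simp add: t_def abs_square_less_1)
  have sp: "s powr (\<alpha> + 2) = s\<^sup>2 * s powr \<alpha>" using s by (simp add: powr_add powr_numeral)
  have gen: "(cmod (p * q))\<^sup>2 * s powr (\<alpha> + 2) \<le> \<epsilon>\<^sup>2 * ((cmod q)\<^sup>2 * s powr \<alpha>)" if "cmod p * s \<le> \<epsilon>" for p q
  proof -
    have "(cmod p * s)\<^sup>2 \<le> \<epsilon>\<^sup>2" using that s by (intro power_mono) auto
    hence "(cmod p * s)\<^sup>2 * ((cmod q)\<^sup>2 * s powr \<alpha>) \<le> \<epsilon>\<^sup>2 * ((cmod q)\<^sup>2 * s powr \<alpha>)" by (intro mult_right_mono) auto
    moreover have "(cmod (p * q))\<^sup>2 * s powr (\<alpha> + 2) = (cmod p * s)\<^sup>2 * ((cmod q)\<^sup>2 * s powr \<alpha>)"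
      unfolding sp norm_mult power_mult_distrib by (simp only: mult_ac)
    ultimately show ?thesis by simp
  qed
  let ?A = "(deriv ^^ 2) \<psi> z * h (\<phi> z)"
  let ?B = "2 * (deriv \<phi> z * deriv \<psi> z) * deriv h (\<phi> z)"
  let ?C = "((deriv ^^ 2) \<phi> z * \<psi> z) * deriv h (\<phi> z)"
  let ?D = "(deriv \<phi> z * \<psi> z) * (deriv \<phi> z * deriv (deriv h) (\<phi> z))"
  let ?w = "s powr (\<alpha> + 2)"
  have A: "(cmod ?A)\<^sup>2 * ?w \<le> \<epsilon>\<^sup>2 * ((cmod (h (\<phi> z)))\<^sup>2 * s powr \<alpha>)"
    using b1 by (intro gen) (simp add: s_def)
  have "(cmod ((deriv \<phi> z * deriv \<psi> z) * deriv h (\<phi> z)))\<^sup>2 * ?w \<le> \<epsilon>\<^sup>2 * ((cmod (deriv h (\<phi> z)))\<^sup>2 * s powr \<alpha>)"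
    using b2 by (intro gen) (simp add: s_def)
  moreover have "(cmod ?B)\<^sup>2 = 4 * (cmod ((deriv \<phi> z * deriv \<psi> z) * deriv h (\<phi> z)))\<^sup>2"
    by (simp add: norm_mult power_mult_distrib)
  ultimately have B: "(cmod ?B)\<^sup>2 * ?w \<le> 4 * (\<epsilon>\<^sup>2 * ((cmod (deriv h (\<phi> z)))\<^sup>2 * s powr \<alpha>))" by simp
  have C: "(cmod ?C)\<^sup>2 * ?w \<le> \<epsilon>\<^sup>2 * ((cmod (deriv h (\<phi> z)))\<^sup>2 * s powr \<alpha>)"
    using b3 by (intro gen) (simp add: s_def)
  have D: "(cmod ?D)\<^sup>2 * ?w \<le> \<epsilon>\<^sup>2 * ((cmod (deriv \<phi> z))\<^sup>2 * ((cmod (deriv (deriv h) (\<phi> z)))\<^sup>2 * t powr (\<alpha> + 2)))"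
  proof -
    let ?q = "(cmod (deriv \<phi> z))\<^sup>2 * (cmod (deriv (deriv h) (\<phi> z)))\<^sup>2"
    have "(cmod (deriv \<phi> z * \<psi> z) * (s / t) powr (\<alpha> / 2 + 1))\<^sup>2 \<le> \<epsilon>\<^sup>2"
      using b4 by (intro power_mono) (auto simp: s_def t_def)
    moreover have "((s / t) powr (\<alpha> / 2 + 1))\<^sup>2 = ?w / t powr (\<alpha> + 2)"
    proof -
      have "((s / t) powr (\<alpha> / 2 + 1))\<^sup>2 = (s / t) powr ((\<alpha> / 2 + 1) + (\<alpha> / 2 + 1))"
        unfolding powr_add by (rule power2_eq_square)
      also have "(\<alpha> / 2 + 1) + (\<alpha> / 2 + 1) = \<alpha> + 2" by simp
      finally show ?thesis using s t by (simp add: powr_divide)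
    qed
    ultimately have "(cmod (deriv \<phi> z * \<psi> z))\<^sup>2 * (?w / t powr (\<alpha> + 2)) \<le> \<epsilon>\<^sup>2"
      by (simp only: power_mult_distrib)
    hence "(cmod (deriv \<phi> z * \<psi> z))\<^sup>2 * ?w \<le> \<epsilon>\<^sup>2 * t powr (\<alpha> + 2)"
      using t by (simp add: pos_divide_le_eq)
    from mult_right_mono[OF this, of ?q]
    have "(cmod (deriv \<phi> z * \<psi> z))\<^sup>2 * ?w * ?q \<le> \<epsilon>\<^sup>2 * t powr (\<alpha> + 2) * ?q" by simp
    moreover have "(cmod ?D)\<^sup>2 * ?w = (cmod (deriv \<phi> z * \<psi> z))\<^sup>2 * ?w * ?q"
    proof -
      have "(cmod (p * (x * y)))\<^sup>2 = (cmod p)\<^sup>2 * ((cmod x)\<^sup>2 * (cmod y)\<^sup>2)" for p x y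
        by (simp add: norm_mult power_mult_distrib)
      note split = this
      show ?thesis
        unfolding split[of "deriv \<phi> z * \<psi> z" "deriv \<phi> z" "deriv (deriv h) (\<phi> z)"] by (simp only: mult_ac)
    qed
    ultimately show ?thesis by (simp only: mult_ac)
  qed
  have "(cmod (deriv (deriv (wcomp \<psi> \<phi> h)) z))\<^sup>2 * ?w \<le> 4 * ((cmod ?A)\<^sup>2 + (cmod ?B)\<^sup>2 + (cmod ?C)\<^sup>2 + (cmod ?D)\<^sup>2) * ?w"
    unfolding wcomp_deriv2[OF \<psi> \<phi> h z] by (intro mult_right_mono norm_sum4_square_le) auto
  also have "\<dots> = 4 * ((cmod ?A)\<^sup>2 * ?w + (cmod ?B)\<^sup>2 * ?w + (cmod ?C)\<^sup>2 * ?w + (cmod ?D)\<^sup>2 * ?w)"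
    by (simp only: distrib_right mult.assoc)
  also have "\<dots> \<le> 4 * (\<epsilon>\<^sup>2 * ((cmod (h (\<phi> z)))\<^sup>2 * s powr \<alpha>) + 4 * (\<epsilon>\<^sup>2 * ((cmod (deriv h (\<phi> z)))\<^sup>2 * s powr \<alpha>))
      + \<epsilon>\<^sup>2 * ((cmod (deriv h (\<phi> z)))\<^sup>2 * s powr \<alpha>) + \<epsilon>\<^sup>2 * ((cmod (deriv \<phi> z))\<^sup>2 * ((cmod (deriv (deriv h) (\<phi> z)))\<^sup>2 * t powr (\<alpha> + 2))))"
    by (intro mult_left_mono add_mono A B C D) simp
  also have "\<dots> = 4 * \<epsilon>\<^sup>2 * ((cmod (h (\<phi> z)))\<^sup>2 * s powr \<alpha>) + 20 * \<epsilon>\<^sup>2 * ((cmod (deriv h (\<phi> z)))\<^sup>2 * s powr \<alpha>)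
      + 4 * \<epsilon>\<^sup>2 * ((cmod (deriv \<phi> z))\<^sup>2 * ((cmod (deriv (deriv h) (\<phi> z)))\<^sup>2 * t powr (\<alpha> + 2)))"
  proof -
    have "4 * (e * a + 4 * (e * b) + e * b + e * c) = 4 * e * a + 20 * e * b + 4 * e * c" for a b c e :: real
      by (simp add: algebra_simps)
    thus ?thesis .
  qed
  finally show ?thesis unfolding s_def t_def .
qed

lemma continuous_disc_weighted_square:
  assumes "g holomorphic_on ball 0 1"
  shows "continuous_on (ball 0 1) (\<lambda>z. (cmod (g z))\<^sup>2 * (1 - (cmod z)\<^sup>2) powr \<beta>)"
  by (rule continuous_on_mult[OF continuous_on_power[OF continuous_on_norm[OF
        holomorphic_on_imp_continuous_on[OF assms]]] continuous_disc_weight])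

lemma eventually_to_unit_circleD:
  assumes "eventually P to_unit_circle"
  shows "\<exists>r. 0 < r \<and> r < 1 \<and> (\<forall>z. r < cmod z \<and> cmod z < 1 \<longrightarrow> P z)"
proof -
  from assms obtain Q where Q: "eventually Q (at_left (1::real))" "\<And>z. Q (cmod z) \<Longrightarrow> P z"
    unfolding to_unit_circle_def eventually_filtercomap by auto
  from Q(1) obtain b where b: "b < 1" "\<And>y. b < y \<Longrightarrow> y < 1 \<Longrightarrow> Q y"
    using eventually_at_left[of 0 "1::real" Q] by auto
  show ?thesis by (rule exI[of _ "max b (1/2)"]) (use b Q(2) in auto)
qed

lemma to_unit_circle_smallD:
  assumes "(g \<longlongrightarrow> 0) to_unit_circle" "\<epsilon> > (0::real)"
  shows "eventually (\<lambda>z. g z \<le> \<epsilon>) to_unit_circle"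
  using tendstoD[OF assms] by eventually_elim (auto simp: dist_real_def)

lemma ennreal_linear_combination3:
  assumes "0 \<le> a" "0 \<le> b" "0 \<le> c" "0 \<le> x" "0 \<le> y" "0 \<le> z"
  shows "ennreal (a * x + b * y + c * z) = ennreal a * ennreal x + ennreal b * ennreal y + ennreal c * ennreal z"
  using assms by (simp add: ennreal_plus ennreal_mult)

lemma nn_integral_linear_combination3:
  fixes a b c :: ennreal
  assumes [measurable]: "f \<in> borel_measurable M" "g \<in> borel_measurable M" "h \<in> borel_measurable M"
  shows "(\<integral>\<^sup>+z. a * f z + b * g z + c * h z \<partial>M)
     = a * (\<integral>\<^sup>+z. f z \<partial>M) + b * (\<integral>\<^sup>+z. g z \<partial>M) + c * (\<integral>\<^sup>+z. h z \<partial>M)"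
  by (simp add: nn_integral_add nn_integral_cmult)

text \<open>
  Integrating the pointwise bound over the annulus. The terms with \<open>h \<circ> \<phi>\<close> and \<open>h' \<circ> \<phi>\<close> are controlled by
  boundedness of the composition operator on the Bergman space of weight \<open>\<alpha>\<close>, the one with
  \<open>h'' \<circ> \<phi>\<close> by univalence. Neither the radius nor the constant depends on \<open>h\<close>.
\<close>

lemma wcomp_boundary_estimate:
  assumes \<alpha>: "-1 < \<alpha>" "\<alpha> < 1" and \<phi>: "holo_self_map \<phi>" and inj: "inj_on \<phi> unit_disc"
    and \<psi>: "\<psi> holomorphic_on unit_disc"
    and c1: "((\<lambda>z. cmod ((deriv ^^ 2) \<psi> z) * (1 - (cmod z)\<^sup>2)) \<longlongrightarrow> 0) to_unit_circle"
    and c2: "((\<lambda>z. cmod (deriv \<phi> z * deriv \<psi> z) * (1 - (cmod z)\<^sup>2)) \<longlongrightarrow> 0) to_unit_circle"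
    and c3: "((\<lambda>z. cmod ((deriv ^^ 2) \<phi> z * \<psi> z) * (1 - (cmod z)\<^sup>2)) \<longlongrightarrow> 0) to_unit_circle"
    and c4: "((\<lambda>z. cmod (deriv \<phi> z * \<psi> z) *
            ((1 - (cmod z)\<^sup>2) / (1 - (cmod (\<phi> z))\<^sup>2)) powr (\<alpha> / 2 + 1)) \<longlongrightarrow> 0) to_unit_circle"
  obtains K where "K > 0" "\<And>\<epsilon>. \<epsilon> > 0 \<Longrightarrow> \<exists>r. 0 < r \<and> r < 1 \<and> (\<forall>h. h holomorphic_on ball 0 1 \<longrightarrow>
     (\<integral>\<^sup>+z. indicator (- cball 0 r) z * (indicator (ball 0 1) z * ennreal ((cmod (deriv (deriv (wcomp \<psi> \<phi> h)) z))\<^sup>2 * (1 - (cmod z)\<^sup>2) powr (\<alpha> + 2))) \<partial>lborel)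
      \<le> ennreal (\<epsilon>\<^sup>2 * K) * dirichlet_energy \<alpha> h)"
proof -
  have h\<phi>: "\<phi> holomorphic_on ball 0 1" and self: "\<phi> ` ball 0 1 \<subseteq> ball 0 1" by (rule holo_self_mapD[OF \<phi>])+
  obtain L where L: "L > 0" "\<And>f. f holomorphic_on ball 0 1 \<Longrightarrow> bergman_integral \<alpha> (\<lambda>z. f (\<phi> z)) \<le> ennreal L * bergman_integral \<alpha> f"
    by (rule bergman_integral_self_map[OF \<phi> \<alpha>(1)], blast)
  obtain C0 where C0: "C0 > 0" "\<And>f. f holomorphic_on ball 0 1 \<Longrightarrow> bergman_integral \<alpha> f \<le> ennreal C0 * dirichlet_energy \<alpha> f"
    by (rule bergman_integral_le_energy[OF \<alpha>(1)], blast)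
  obtain C1 where C1: "C1 > 0" "\<And>f. f holomorphic_on ball 0 1 \<Longrightarrow> bergman_integral \<alpha> (deriv f) \<le> ennreal C1 * dirichlet_energy \<alpha> f"
    by (rule bergman_integral_deriv_le_energy[OF \<alpha>], blast)
  obtain C2 where C2: "C2 > 0" "\<And>f. f holomorphic_on ball 0 1 \<Longrightarrow> bergman_integral (\<alpha>+2) (deriv (deriv f)) \<le> ennreal C2 * dirichlet_energy \<alpha> f"
    by (rule bergman_integral_deriv2_le_energy[OF \<alpha>], blast)
  \<comment> \<open>The weights are those of the pointwise bound; the 20 collects the two terms with \<open>h'\<close>, one of which
    has coefficient 2 in the second derivative.\<close>
  define K where "K = 4 * L * C0 + 20 * L * C1 + 4 * C2"
  show ?thesis
  proof (rule that[of K])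
    show "K > 0" using L(1) C0(1) C1(1) C2(1) by (simp add: K_def add_pos_pos)
    fix \<epsilon> :: real assume \<epsilon>: "\<epsilon> > 0"
    define P where "P = (\<lambda>z. cmod ((deriv ^^ 2) \<psi> z) * (1 - (cmod z)\<^sup>2) \<le> \<epsilon> \<and>
       cmod (deriv \<phi> z * deriv \<psi> z) * (1 - (cmod z)\<^sup>2) \<le> \<epsilon> \<and>
       cmod ((deriv ^^ 2) \<phi> z * \<psi> z) * (1 - (cmod z)\<^sup>2) \<le> \<epsilon> \<and>
       cmod (deriv \<phi> z * \<psi> z) * ((1 - (cmod z)\<^sup>2) / (1 - (cmod (\<phi> z))\<^sup>2)) powr (\<alpha> / 2 + 1) \<le> \<epsilon>)"
    have "eventually P to_unit_circle" unfolding P_def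
      by (intro eventually_conj to_unit_circle_smallD c1 c2 c3 c4 \<epsilon>)
    then obtain r where r: "0 < r" "r < 1" and small: "\<And>z. r < cmod z \<Longrightarrow> cmod z < 1 \<Longrightarrow> P z"
      using eventually_to_unit_circleD[of P] by blast
    have "(\<integral>\<^sup>+z. indicator (- cball 0 r) z * (indicator (ball 0 1) z * ennreal ((cmod (deriv (deriv (wcomp \<psi> \<phi> h)) z))\<^sup>2 * (1 - (cmod z)\<^sup>2) powr (\<alpha> + 2))) \<partial>lborel)
      \<le> ennreal (\<epsilon>\<^sup>2 * K) * dirichlet_energy \<alpha> h" if h: "h holomorphic_on ball 0 1" for h
    proof -
      note h' = holomorphic_deriv[OF h open_ball]
      note h'' = holomorphic_deriv[OF h' open_ball]
      let ?u1 = "\<lambda>z. (cmod (h (\<phi> z)))\<^sup>2 * (1 - (cmod z)\<^sup>2) powr \<alpha>"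
      let ?u2 = "\<lambda>z. (cmod (deriv h (\<phi> z)))\<^sup>2 * (1 - (cmod z)\<^sup>2) powr \<alpha>"
      let ?v = "\<lambda>w. (cmod (deriv (deriv h) w))\<^sup>2 * (1 - (cmod w)\<^sup>2) powr (\<alpha> + 2)"
      let ?u3 = "\<lambda>z. (cmod (deriv \<phi> z))\<^sup>2 * ?v (\<phi> z)"
      let ?X = "\<lambda>u z. indicator (ball 0 1) z * ennreal (u z)"
      note cont = continuous_disc_weighted_square
      have cv: "continuous_on (ball 0 1) ?v" by (rule cont[OF h''])
      have c\<phi>: "continuous_on (ball 0 1) (\<lambda>z. ?v (\<phi> z))"
        by (rule continuous_on_compose2[OF cv holomorphic_on_imp_continuous_on[OF h\<phi>] self])
      have cu3: "continuous_on (ball 0 1) ?u3"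
        by (rule continuous_on_mult[OF continuous_on_power[OF continuous_on_norm[OF
              holomorphic_on_imp_continuous_on[OF holomorphic_deriv[OF h\<phi> open_ball]]]] c\<phi>])
      have m1: "?X ?u1 \<in> borel_measurable borel"
        by (rule measurable_disc_indicator[OF cont[OF holomorphic_self_map_compose[OF \<phi> h]]])
      have m2: "?X ?u2 \<in> borel_measurable borel"
        by (rule measurable_disc_indicator[OF cont[OF holomorphic_self_map_compose[OF \<phi> h']]])
      have m3: "?X ?u3 \<in> borel_measurable borel"
        by (rule measurable_disc_indicator[OF cu3])
      have I1: "(\<integral>\<^sup>+z. ?X ?u1 z \<partial>lborel) \<le> ennreal (L * C0) * dirichlet_energy \<alpha> h"
      proof -
        have "(\<integral>\<^sup>+z. ?X ?u1 z \<partial>lborel) \<le> ennreal L * bergman_integral \<alpha> h"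
          using L(2)[OF h] by (simp add: bergman_integral_def)
        also have "\<dots> \<le> ennreal L * (ennreal C0 * dirichlet_energy \<alpha> h)" by (intro mult_left_mono C0 h) simp
        finally show ?thesis using L(1) C0(1) by (simp add: ennreal_mult mult.assoc)
      qed
      have I2: "(\<integral>\<^sup>+z. ?X ?u2 z \<partial>lborel) \<le> ennreal (L * C1) * dirichlet_energy \<alpha> h"
      proof -
        have "(\<integral>\<^sup>+z. ?X ?u2 z \<partial>lborel) \<le> ennreal L * bergman_integral \<alpha> (deriv h)"
          using L(2)[OF h'] by (simp add: bergman_integral_def)
        also have "\<dots> \<le> ennreal L * (ennreal C1 * dirichlet_energy \<alpha> h)" by (intro mult_left_mono C1 h) simp
        finally show ?thesis using L(1) C1(1) by (simp add: ennreal_mult mult.assoc)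
      qed
      have I3: "(\<integral>\<^sup>+z. ?X ?u3 z \<partial>lborel) \<le> ennreal C2 * dirichlet_energy \<alpha> h"
      proof -
        have "(\<integral>\<^sup>+z. ?X ?u3 z \<partial>lborel) \<le> bergman_integral (\<alpha>+2) (deriv (deriv h))"
          unfolding bergman_integral_def by (rule nn_integral_univalent_disc_le[OF h\<phi> inj self cv])
        also have "\<dots> \<le> ennreal C2 * dirichlet_energy \<alpha> h" by (rule C2(2)[OF h])
        finally show ?thesis .
      qed
      have "(\<integral>\<^sup>+z. indicator (- cball 0 r) z * (indicator (ball 0 1) z * ennreal ((cmod (deriv (deriv (wcomp \<psi> \<phi> h)) z))\<^sup>2 * (1 - (cmod z)\<^sup>2) powr (\<alpha> + 2))) \<partial>lborel)
        \<le> (\<integral>\<^sup>+z. ennreal (4 * \<epsilon>\<^sup>2) * ?X ?u1 z + ennreal (20 * \<epsilon>\<^sup>2) * ?X ?u2 z + ennreal (4 * \<epsilon>\<^sup>2) * ?X ?u3 z \<partial>lborel)"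
      proof (intro nn_integral_mono)
        fix z :: complex
        show "indicator (- cball 0 r) z * (indicator (ball 0 1) z * ennreal ((cmod (deriv (deriv (wcomp \<psi> \<phi> h)) z))\<^sup>2 * (1 - (cmod z)\<^sup>2) powr (\<alpha> + 2)))
          \<le> ennreal (4 * \<epsilon>\<^sup>2) * ?X ?u1 z + ennreal (20 * \<epsilon>\<^sup>2) * ?X ?u2 z + ennreal (4 * \<epsilon>\<^sup>2) * ?X ?u3 z"
        proof (cases "r < cmod z \<and> cmod z < 1")
          case True
          have Pz: "P z" using small True by blast
          have zD: "z \<in> ball 0 1" using True by simp
          have "ennreal ((cmod (deriv (deriv (wcomp \<psi> \<phi> h)) z))\<^sup>2 * (1 - (cmod z)\<^sup>2) powr (\<alpha> + 2)) \<le> ennreal (4 * \<epsilon>\<^sup>2 * ?u1 z + 20 * \<epsilon>\<^sup>2 * ?u2 z + 4 * \<epsilon>\<^sup>2 * ?u3 z)"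
            using Pz[unfolded P_def]
            by (elim conjE, intro ennreal_leI, intro wcomp_deriv2_pointwise[OF \<psi> \<phi> h zD less_imp_le[OF \<epsilon>]])
          also have "\<dots> = ennreal (4 * \<epsilon>\<^sup>2) * ennreal (?u1 z) + ennreal (20 * \<epsilon>\<^sup>2) * ennreal (?u2 z) + ennreal (4 * \<epsilon>\<^sup>2) * ennreal (?u3 z)"
            by (rule ennreal_linear_combination3) auto
          finally show ?thesis using True by simp
        qed auto
      qed
      also have "\<dots> = ennreal (4 * \<epsilon>\<^sup>2) * (\<integral>\<^sup>+z. ?X ?u1 z \<partial>lborel) + ennreal (20 * \<epsilon>\<^sup>2) * (\<integral>\<^sup>+z. ?X ?u2 z \<partial>lborel)
          + ennreal (4 * \<epsilon>\<^sup>2) * (\<integral>\<^sup>+z. ?X ?u3 z \<partial>lborel)"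
        by (rule nn_integral_linear_combination3) (simp_all only: m1 m2 m3 measurable_lborel2)
      also have "\<dots> \<le> ennreal (4 * \<epsilon>\<^sup>2) * (ennreal (L * C0) * dirichlet_energy \<alpha> h) + ennreal (20 * \<epsilon>\<^sup>2) * (ennreal (L * C1) * dirichlet_energy \<alpha> h)
          + ennreal (4 * \<epsilon>\<^sup>2) * (ennreal C2 * dirichlet_energy \<alpha> h)"
        by (intro add_mono mult_left_mono I1 I2 I3) auto
      also have "\<dots> = (ennreal (4 * \<epsilon>\<^sup>2) * ennreal (L * C0) + ennreal (20 * \<epsilon>\<^sup>2) * ennreal (L * C1) + ennreal (4 * \<epsilon>\<^sup>2) * ennreal C2) * dirichlet_energy \<alpha> h"
        by (simp only: distrib_right mult.assoc)
      also have "ennreal (4 * \<epsilon>\<^sup>2) * ennreal (L * C0) + ennreal (20 * \<epsilon>\<^sup>2) * ennreal (L * C1) + ennreal (4 * \<epsilon>\<^sup>2) * ennreal C2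
        = ennreal (4 * \<epsilon>\<^sup>2 * (L * C0) + 20 * \<epsilon>\<^sup>2 * (L * C1) + 4 * \<epsilon>\<^sup>2 * C2)"
        using L(1) C0(1) C1(1) C2(1) by (intro ennreal_linear_combination3[symmetric]) auto
      also have "4 * \<epsilon>\<^sup>2 * (L * C0) + 20 * \<epsilon>\<^sup>2 * (L * C1) + 4 * \<epsilon>\<^sup>2 * C2 = \<epsilon>\<^sup>2 * K"
        by (simp add: K_def algebra_simps)
      finally show ?thesis .
    qed
    thus "\<exists>r. 0 < r \<and> r < 1 \<and> (\<forall>h. h holomorphic_on ball 0 1 \<longrightarrow>
     (\<integral>\<^sup>+z. indicator (- cball 0 r) z * (indicator (ball 0 1) z * ennreal ((cmod (deriv (deriv (wcomp \<psi> \<phi> h)) z))\<^sup>2 * (1 - (cmod z)\<^sup>2) powr (\<alpha> + 2))) \<partial>lborel)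
      \<le> ennreal (\<epsilon>\<^sup>2 * K) * dirichlet_energy \<alpha> h)"
      using r by (intro exI[of _ r] conjI allI impI)
  qed
qed

text \<open>
  On the inner disc the weight is at most one because \<open>\<beta>\<close> is nonnegative.
\<close>

lemma bergman_integral_split:
  assumes \<beta>: "0 \<le> \<beta>" and G: "G holomorphic_on ball 0 1" and r: "r < 1"
    and M: "\<And>z. cmod z \<le> r \<Longrightarrow> cmod (G z) \<le> M"
  shows "bergman_integral \<beta> G \<le> ennreal (pi * M\<^sup>2) +
     (\<integral>\<^sup>+z. indicator (- cball 0 r) z * (indicator (ball 0 1) z * ennreal ((cmod (G z))\<^sup>2 * (1 - (cmod z)\<^sup>2) powr \<beta>)) \<partial>lborel)"
proof -
  let ?X = "\<lambda>z. indicator (ball 0 1) z * ennreal ((cmod (G z))\<^sup>2 * (1 - (cmod z)\<^sup>2) powr \<beta>)"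
  have [measurable]: "?X \<in> borel_measurable borel"
    by (rule measurable_disc_indicator[OF continuous_disc_weighted_square[OF G]])
  have [measurable]: "- cball (0::complex) r \<in> sets borel" by (intro borel_open) auto
  have "bergman_integral \<beta> G \<le> (\<integral>\<^sup>+z. ennreal (M\<^sup>2) * indicator (ball 0 1) z + indicator (- cball 0 r) z * ?X z \<partial>lborel)"
    unfolding bergman_integral_def
  proof (intro nn_integral_mono)
    fix z :: complex
    show "?X z \<le> ennreal (M\<^sup>2) * indicator (ball 0 1) z + indicator (- cball 0 r) z * ?X z"
    proof (cases "cmod z \<le> r")
      case True
      have "(1 - (cmod z)\<^sup>2) powr \<beta> \<le> 1" if "cmod z < 1"
        using that \<beta> by (intro powr_le1) (auto simp: abs_square_le_1)
      moreover have "(cmod (G z))\<^sup>2 \<le> M\<^sup>2" using M[OF True] by (intro power_mono) auto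
      ultimately have "(cmod (G z))\<^sup>2 * (1 - (cmod z)\<^sup>2) powr \<beta> \<le> M\<^sup>2 * 1" if "cmod z < 1"
        using that by (intro mult_mono) auto
      thus ?thesis using True r by (auto intro: ennreal_leI)
    qed auto
  qed
  also have "\<dots> = ennreal (M\<^sup>2) * emeasure lborel (ball (0::complex) 1) + (\<integral>\<^sup>+z. indicator (- cball 0 r) z * ?X z \<partial>lborel)"
    by (subst nn_integral_add) (auto simp: nn_integral_cmult_indicator)
  also have "emeasure lborel (ball (0::complex) 1) = ennreal pi" by (rule emeasure_unit_disc)
  also have "ennreal (M\<^sup>2) * ennreal pi = ennreal (pi * M\<^sup>2)" by (subst ennreal_mult'[symmetric]) (simp_all add: mult.commute)
  finally show ?thesis .
qed

section \<open>Growth, coefficients and locally uniform limits in Dirichlet spaces\<close>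

text \<open>
  The estimate behind compactness: up to a small multiple of the norm of \<open>h\<close>, the image is controlled by
  quantities that live on a compact subset of the disc. Applied to a single \<open>h\<close> it gives membership in the space,
  applied to a sequence it gives convergence.
\<close>

lemma wcomp_energy_estimate:
  assumes \<alpha>: "-1 < \<alpha>" "\<alpha> < 1" and \<phi>: "holo_self_map \<phi>" and inj: "inj_on \<phi> unit_disc"
    and \<psi>: "\<psi> holomorphic_on unit_disc"
    and c1: "((\<lambda>z. cmod ((deriv ^^ 2) \<psi> z) * (1 - (cmod z)\<^sup>2)) \<longlongrightarrow> 0) to_unit_circle"
    and c2: "((\<lambda>z. cmod (deriv \<phi> z * deriv \<psi> z) * (1 - (cmod z)\<^sup>2)) \<longlongrightarrow> 0) to_unit_circle"
    and c3: "((\<lambda>z. cmod ((deriv ^^ 2) \<phi> z * \<psi> z) * (1 - (cmod z)\<^sup>2)) \<longlongrightarrow> 0) to_unit_circle"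
    and c4: "((\<lambda>z. cmod (deriv \<phi> z * \<psi> z) *
            ((1 - (cmod z)\<^sup>2) / (1 - (cmod (\<phi> z))\<^sup>2)) powr (\<alpha> / 2 + 1)) \<longlongrightarrow> 0) to_unit_circle"
  obtains K where "K > 0" "\<And>\<epsilon>. \<epsilon> > 0 \<Longrightarrow> \<exists>r. 0 < r \<and> r < 1 \<and> (\<forall>h M. h holomorphic_on ball 0 1 \<longrightarrow>
     (\<forall>z. cmod z \<le> r \<longrightarrow> cmod (deriv (deriv (wcomp \<psi> \<phi> h)) z) \<le> M) \<longrightarrow>
     dirichlet_energy \<alpha> (wcomp \<psi> \<phi> h) \<le>
       ennreal (dirichlet_term \<alpha> (wcomp \<psi> \<phi> h) 0 + dirichlet_term \<alpha> (wcomp \<psi> \<phi> h) 1 + K * M\<^sup>2)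
       + ennreal (K * \<epsilon>\<^sup>2) * dirichlet_energy \<alpha> h)"
proof -
  let ?R = "\<lambda>r h. \<integral>\<^sup>+z. indicator (- cball 0 r) z * (indicator (ball 0 1) z *
      ennreal ((cmod (deriv (deriv (wcomp \<psi> \<phi> h)) z))\<^sup>2 * (1 - (cmod z)\<^sup>2) powr (\<alpha> + 2))) \<partial>lborel"
  obtain K1 where K1: "K1 > 0" "\<And>F. F holomorphic_on ball 0 1 \<Longrightarrow> dirichlet_energy \<alpha> F \<le>
      ennreal (dirichlet_term \<alpha> F 0) + ennreal (dirichlet_term \<alpha> F 1) + ennreal K1 * bergman_integral (\<alpha>+2) (deriv (deriv F))"
    by (rule energy_le_bergman_integral[OF \<alpha>], blast)
  obtain K2 where K2: "K2 > 0" "\<And>\<epsilon>. \<epsilon> > 0 \<Longrightarrow> \<exists>r. 0 < r \<and> r < 1 \<and> (\<forall>h. h holomorphic_on ball 0 1 \<longrightarrow>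
      ?R r h \<le> ennreal (\<epsilon>\<^sup>2 * K2) * dirichlet_energy \<alpha> h)"
    by (rule wcomp_boundary_estimate[OF assms], rule that)
  define K where "K = K1 * pi + K1 * K2"
  show ?thesis
  proof (rule that[of K])
    show "K > 0" using K1(1) K2(1) by (simp add: K_def add_pos_pos)
    fix \<epsilon> :: real assume \<epsilon>: "\<epsilon> > 0"
    obtain r where r: "0 < r" "r < 1" and
      R': "\<forall>h. h holomorphic_on ball 0 1 \<longrightarrow> ?R r h \<le> ennreal (\<epsilon>\<^sup>2 * K2) * dirichlet_energy \<alpha> h"
      by (rule exE[OF K2(2)[OF \<epsilon>]], elim conjE, rule that)
    note R = R'[rule_format]
    have est: "dirichlet_energy \<alpha> F \<le> ennreal (dirichlet_term \<alpha> F 0 + dirichlet_term \<alpha> F 1 + K * M\<^sup>2)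
       + ennreal (K * \<epsilon>\<^sup>2) * dirichlet_energy \<alpha> h"
      if h: "h holomorphic_on ball 0 1" and M: "\<And>z. cmod z \<le> r \<Longrightarrow> cmod (deriv (deriv F) z) \<le> M"
        and F: "F = wcomp \<psi> \<phi> h" for h M F
    proof -
      have hol: "F holomorphic_on ball 0 1" unfolding F by (rule holomorphic_wcomp[OF \<psi> \<phi> h])
      have "bergman_integral (\<alpha>+2) (deriv (deriv F)) \<le> ennreal (pi * M\<^sup>2) + ?R r h"
        unfolding F[symmetric]
        by (rule bergman_integral_split[OF _ holomorphic_deriv[OF holomorphic_deriv[OF hol open_ball] open_ball] r(2) M])
           (use \<alpha> in auto)
      also have "\<dots> \<le> ennreal (pi * M\<^sup>2) + ennreal (\<epsilon>\<^sup>2 * K2) * dirichlet_energy \<alpha> h"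
        by (intro add_left_mono R h)
      finally have B: "bergman_integral (\<alpha>+2) (deriv (deriv F)) \<le> ennreal (pi * M\<^sup>2) + ennreal (\<epsilon>\<^sup>2 * K2) * dirichlet_energy \<alpha> h" .
      have "ennreal K1 * bergman_integral (\<alpha>+2) (deriv (deriv F)) \<le> ennreal K1 * (ennreal (pi * M\<^sup>2) + ennreal (\<epsilon>\<^sup>2 * K2) * dirichlet_energy \<alpha> h)"
        by (rule mult_left_mono[OF B]) simp
      also have "\<dots> = ennreal (K1 * (pi * M\<^sup>2)) + ennreal (K1 * (\<epsilon>\<^sup>2 * K2)) * dirichlet_energy \<alpha> h"
        using K1(1) K2(1) by (simp add: distrib_left ennreal_mult mult.assoc)
      also have "\<dots> \<le> ennreal (K * M\<^sup>2) + ennreal (K * \<epsilon>\<^sup>2) * dirichlet_energy \<alpha> h"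
        using K1(1) K2(1) by (intro add_mono mult_right_mono ennreal_leI) (auto simp: K_def algebra_simps)
      finally have "ennreal K1 * bergman_integral (\<alpha>+2) (deriv (deriv F)) \<le> ennreal (K * M\<^sup>2) + ennreal (K * \<epsilon>\<^sup>2) * dirichlet_energy \<alpha> h" .
      hence "dirichlet_energy \<alpha> F \<le> ennreal (dirichlet_term \<alpha> F 0) + ennreal (dirichlet_term \<alpha> F 1)
          + (ennreal (K * M\<^sup>2) + ennreal (K * \<epsilon>\<^sup>2) * dirichlet_energy \<alpha> h)"
        by (rule order_trans[OF K1(2)[OF hol] add_left_mono])
      also have "\<dots> = ennreal (dirichlet_term \<alpha> F 0 + dirichlet_term \<alpha> F 1 + K * M\<^sup>2) + ennreal (K * \<epsilon>\<^sup>2) * dirichlet_energy \<alpha> h"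
        using K1(1) K2(1) by (simp add: ennreal_plus K_def add.assoc)
      finally show ?thesis .
    qed
    show "\<exists>r. 0 < r \<and> r < 1 \<and> (\<forall>h M. h holomorphic_on ball 0 1 \<longrightarrow>
     (\<forall>z. cmod z \<le> r \<longrightarrow> cmod (deriv (deriv (wcomp \<psi> \<phi> h)) z) \<le> M) \<longrightarrow>
     dirichlet_energy \<alpha> (wcomp \<psi> \<phi> h) \<le>
       ennreal (dirichlet_term \<alpha> (wcomp \<psi> \<phi> h) 0 + dirichlet_term \<alpha> (wcomp \<psi> \<phi> h) 1 + K * M\<^sup>2)
       + ennreal (K * \<epsilon>\<^sup>2) * dirichlet_energy \<alpha> h)"
      by (intro exI[of _ r] conjI allI impI r, rule est[OF _ _ refl]) blast+
  qed
qed

lemma taylor_coeff_le_norm: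
  assumes f: "f \<in> dirichlet_space \<alpha>" and \<alpha>: "\<alpha> < 1"
  shows "cmod (taylor_coeff f n) \<le> dirichlet_norm \<alpha> f"
proof -
  have s: "summable (dirichlet_term \<alpha> f)" using f by (simp add: dirichlet_space_def)
  have "1 * (cmod (taylor_coeff f n))\<^sup>2 \<le> (real n + 1) powr (1 - \<alpha>) * (cmod (taylor_coeff f n))\<^sup>2"
    using \<alpha> by (intro mult_right_mono ge_one_powr_ge_zero) auto
  also have "\<dots> = (\<Sum>k\<in>{n}. dirichlet_term \<alpha> f k)" by (simp add: dirichlet_term_taylor)
  also have "\<dots> \<le> (\<Sum>k. dirichlet_term \<alpha> f k)" using s by (intro sum_le_suminf) auto
  finally show ?thesis unfolding dirichlet_norm_def by (intro real_le_rsqrt) simp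
qed

text \<open>
  Every Taylor coefficient is at most the norm, so a geometric series is a majorant. The bound is far from
  sharp but suffices for local boundedness.
\<close>

lemma dirichlet_growth:
  assumes f: "f \<in> dirichlet_space \<alpha>" and \<alpha>: "\<alpha> < 1" and z: "cmod z < 1"
  shows "cmod (f z) \<le> dirichlet_norm \<alpha> f / (1 - cmod z)"
proof -
  have hol: "f holomorphic_on ball 0 1" using f by (simp add: dirichlet_space_def)
  have g: "(\<lambda>n. dirichlet_norm \<alpha> f * cmod z ^ n) sums (dirichlet_norm \<alpha> f * (1 / (1 - cmod z)))"
    using z by (intro sums_mult geometric_sums) simp
  have s: "(\<lambda>n. taylor_coeff f n * z ^ n) sums f z" by (rule taylor_coeff_sums[OF hol z])
  have "cmod (suminf (\<lambda>n. taylor_coeff f n * z ^ n)) \<le> suminf (\<lambda>n. dirichlet_norm \<alpha> f * cmod z ^ n)"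
    using sums_summable[OF g]
    by (intro norm_suminf_le) (auto simp: norm_mult norm_power intro!: mult_right_mono taylor_coeff_le_norm[OF f \<alpha>])
  thus ?thesis using sums_unique[OF s] sums_unique[OF g] by simp
qed

lemma taylor_coeff_tendsto:
  assumes "\<And>K. compact K \<Longrightarrow> K \<subseteq> ball 0 1 \<Longrightarrow> uniform_limit K f g sequentially"
    and hol: "\<And>k. f k holomorphic_on ball 0 1"
  shows "(\<lambda>k. taylor_coeff (f k) n) \<longlonglongrightarrow> taylor_coeff g n"
proof -
  have "uniform_limit (cball 0 (1/2)) f g sequentially"
    by (intro assms(1)) auto
  hence u: "uniform_limit (ball 0 (1/2)) f g sequentially"
    by (rule uniform_limit_on_subset) auto
  have "(\<lambda>k. (deriv ^^ n) (f k) 0) \<longlonglongrightarrow> (deriv ^^ n) g 0"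
    by (rule higher_deriv_complex_uniform_limit[OF u])
       (auto intro!: always_eventually holomorphic_on_subset[OF hol])
  thus ?thesis unfolding taylor_coeff_def by (intro tendsto_intros) auto
qed

lemma taylor_coeff_diff:
  assumes "f holomorphic_on ball 0 1" "g holomorphic_on ball 0 1"
  shows "taylor_coeff (\<lambda>z. f z - g z) n = taylor_coeff f n - taylor_coeff g n"
  unfolding taylor_coeff_def
  by (subst higher_deriv_diff[OF assms]) (auto simp: diff_divide_distrib)

lemma dirichlet_energy_diff_le:
  assumes "f holomorphic_on ball 0 1" "g holomorphic_on ball 0 1"
  shows "dirichlet_energy \<alpha> (\<lambda>z. f z - g z) \<le> 2 * (dirichlet_energy \<alpha> f + dirichlet_energy \<alpha> g)"
proof -
  have "dirichlet_energy \<alpha> (\<lambda>z. f z - g z) \<le> (\<Sum>n. 2 * (ennreal (dirichlet_term \<alpha> f n) + ennreal (dirichlet_term \<alpha> g n)))"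
    unfolding dirichlet_energy_def
  proof (intro suminf_le allI summableI)
    fix n
    have sq: "(cmod (x - y))\<^sup>2 \<le> 2 * ((cmod x)\<^sup>2 + (cmod y)\<^sup>2)" for x y
    proof -
      have "(cmod (x - y))\<^sup>2 \<le> (cmod x + cmod y)\<^sup>2" by (intro power_mono norm_triangle_ineq4) auto
      also have "\<dots> \<le> 2 * ((cmod x)\<^sup>2 + (cmod y)\<^sup>2)"
        using sum_squares_bound[of "cmod x" "cmod y"] by (simp add: power2_sum)
      finally show ?thesis .
    qed
    have "dirichlet_term \<alpha> (\<lambda>z. f z - g z) n \<le> 2 * (dirichlet_term \<alpha> f n + dirichlet_term \<alpha> g n)"
      using mult_left_mono[OF sq[of "taylor_coeff f n" "taylor_coeff g n"], of "(real n + 1) powr (1 - \<alpha>)"]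
      unfolding dirichlet_term_taylor taylor_coeff_diff[OF assms] by (simp add: algebra_simps)
    hence "ennreal (dirichlet_term \<alpha> (\<lambda>z. f z - g z) n) \<le> ennreal (2 * (dirichlet_term \<alpha> f n + dirichlet_term \<alpha> g n))"
      by (rule ennreal_leI)
    thus "ennreal (dirichlet_term \<alpha> (\<lambda>z. f z - g z) n) \<le> 2 * (ennreal (dirichlet_term \<alpha> f n) + ennreal (dirichlet_term \<alpha> g n))"
      by (simp add: ennreal_mult ennreal_plus)
  qed
  also have "\<dots> = 2 * (dirichlet_energy \<alpha> f + dirichlet_energy \<alpha> g)"
    unfolding dirichlet_energy_def by (simp only: ennreal_suminf_cmult suminf_add[OF summableI summableI])
  finally show ?thesis .
qed

text \<open>
  Fatou's lemma for series: partial sums of the norm pass to the limit coefficientwise.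
\<close>

lemma dirichlet_energy_le_of_coeff_limit:
  assumes lim: "\<And>n. (\<lambda>k. taylor_coeff (f k) n) \<longlonglongrightarrow> taylor_coeff g n"
    and E: "\<And>k. dirichlet_energy \<alpha> (f k) \<le> ennreal E" and E0: "0 \<le> E"
  shows "dirichlet_energy \<alpha> g \<le> ennreal E"
  unfolding dirichlet_energy_def
proof (rule suminf_le_const)
  fix N
  have part: "(\<Sum>n<N. dirichlet_term \<alpha> (f k) n) \<le> E" for k
  proof -
    have "ennreal (\<Sum>n<N. dirichlet_term \<alpha> (f k) n) = (\<Sum>n<N. ennreal (dirichlet_term \<alpha> (f k) n))"
      by (rule sum_ennreal[symmetric]) simp
    also have "\<dots> \<le> dirichlet_energy \<alpha> (f k)" unfolding dirichlet_energy_def by (rule sum_le_suminf) auto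
    also have "\<dots> \<le> ennreal E" by (rule E)
    finally show ?thesis using E0 by simp
  qed
  have "(\<lambda>k. \<Sum>n<N. dirichlet_term \<alpha> (f k) n) \<longlonglongrightarrow> (\<Sum>n<N. dirichlet_term \<alpha> g n)"
    unfolding dirichlet_term_taylor by (intro tendsto_intros lim)
  hence "(\<Sum>n<N. dirichlet_term \<alpha> g n) \<le> E"
    by (rule LIMSEQ_le_const2) (use part in auto)
  thus "(\<Sum>n<N. ennreal (dirichlet_term \<alpha> g n)) \<le> ennreal E"
    by (subst sum_ennreal) (auto intro: ennreal_leI)
qed auto

text \<open>
  Cauchy's estimate on discs of radius \<open>s\<close> that fit between the circle of radius \<open>r\<close> and the unit circle.
\<close>

lemma deriv2_uniformly_small:
  assumes hol: "\<And>k. F k holomorphic_on ball 0 1"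
    and lim: "\<And>K. compact K \<Longrightarrow> K \<subseteq> ball 0 1 \<Longrightarrow> uniform_limit K F (\<lambda>_. 0) sequentially"
    and r: "0 < r" "r < 1" and \<delta>: "0 < \<delta>"
  shows "eventually (\<lambda>k. \<forall>z. cmod z \<le> r \<longrightarrow> cmod (deriv (deriv (F k)) z) \<le> \<delta>) sequentially"
proof -
  \<comment> \<open>Half the distance to the unit circle keeps all these discs in one compact subset.\<close>
  define s where "s = (1 - r) / 2"
  have s: "0 < s" "r + s < 1" using r by (auto simp: s_def field_simps)
  define \<eta> where "\<eta> = \<delta> * s\<^sup>2 / 2"
  have \<eta>: "\<eta> > 0" using \<delta> s by (simp add: \<eta>_def)
  have "uniform_limit (cball 0 (r + s)) F (\<lambda>_. 0) sequentially"
    using s by (intro lim) auto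
  from uniform_limitD[OF this \<eta>] have "eventually (\<lambda>k. \<forall>z\<in>cball 0 (r+s). cmod (F k z) < \<eta>) sequentially"
    by simp
  thus ?thesis
  proof eventually_elim
    fix k assume small: "\<forall>z\<in>cball 0 (r+s). cmod (F k z) < \<eta>"
    show "\<forall>z. cmod z \<le> r \<longrightarrow> cmod (deriv (deriv (F k)) z) \<le> \<delta>"
    proof (intro allI impI)
      fix z assume z: "cmod z \<le> r"
      have sub: "cball z s \<subseteq> cball 0 (r + s)"
        using z by (auto simp: dist_norm) (metis add_mono norm_triangle_sub norm_minus_commute order_trans)
      have sub1: "cball z s \<subseteq> ball 0 1" using sub s by force
      have "cmod ((deriv ^^ 2) (F k) z) \<le> fact 2 * \<eta> / s ^ 2"
      proof (rule Cauchy_higher_deriv_bound)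
        show "F k holomorphic_on ball z s" using holomorphic_on_subset[OF hol] sub1 ball_subset_cball by blast
        show "continuous_on (cball z s) (F k)"
          using continuous_on_subset[OF holomorphic_on_imp_continuous_on[OF hol] sub1] .
        show "F k w \<in> ball 0 \<eta>" if "w \<in> ball z s" for w
        proof -
          have "w \<in> cball 0 (r + s)" using that sub ball_subset_cball by blast
          thus ?thesis using small by simp
        qed
      qed (use s in auto)
      also have "\<dots> = \<delta>" using s by (simp add: \<eta>_def)
      finally show "cmod (deriv (deriv (F k)) z) \<le> \<delta>" by (simp add: numeral_2_eq_2)
    qed
  qed
qed

lemma wcomp_uniform_limit:
  assumes \<psi>: "\<psi> holomorphic_on ball 0 1" and \<phi>: "holo_self_map \<phi>"
    and lim: "\<And>K. compact K \<Longrightarrow> K \<subseteq> ball 0 1 \<Longrightarrow> uniform_limit K h (\<lambda>_. 0) sequentially"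
    and K: "compact K" "K \<subseteq> ball 0 1"
  shows "uniform_limit K (\<lambda>k. wcomp \<psi> \<phi> (h k)) (\<lambda>_. 0) sequentially"
proof (rule uniform_limitI)
  fix e :: real assume e: "e > 0"
  have c\<psi>: "continuous_on K \<psi>" and c\<phi>: "continuous_on K \<phi>"
    using continuous_on_subset[OF holomorphic_on_imp_continuous_on K(2)] \<psi> holo_self_mapD(1)[OF \<phi>] by blast+
  have "bounded (\<psi> ` K)" by (intro compact_imp_bounded compact_continuous_image c\<psi> K)
  then obtain P where P: "P > 0" "\<And>z. z \<in> K \<Longrightarrow> cmod (\<psi> z) \<le> P"
    by (auto simp: bounded_pos)
  have "uniform_limit (\<phi> ` K) h (\<lambda>_. 0) sequentially"
    using holo_self_mapD(2)[OF \<phi>] K by (intro lim compact_continuous_image c\<phi>) blast+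
  from uniform_limitD[OF this, of "e / P"] have "eventually (\<lambda>k. \<forall>w\<in>\<phi> ` K. cmod (h k w) < e / P) sequentially"
    using e P by simp
  thus "eventually (\<lambda>k. \<forall>z\<in>K. dist (wcomp \<psi> \<phi> (h k) z) 0 < e) sequentially"
  proof eventually_elim
    fix k assume small: "\<forall>w\<in>\<phi> ` K. cmod (h k w) < e / P"
    show "\<forall>z\<in>K. dist (wcomp \<psi> \<phi> (h k) z) 0 < e"
    proof
      fix z assume z: "z \<in> K"
      have "cmod (\<psi> z) * cmod (h k (\<phi> z)) \<le> P * cmod (h k (\<phi> z))" using P(2)[OF z] by (intro mult_right_mono) auto
      also have "\<dots> < P * (e / P)" using small z P(1) by (intro mult_strict_left_mono) auto
      finally show "dist (wcomp \<psi> \<phi> (h k) z) 0 < e" using P(1) by (simp add: wcomp_def norm_mult)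
    qed
  qed
qed

section \<open>Compactness\<close>

text \<open>
  Norm-bounded sets are normal families by the growth estimate, so Montel's theorem provides a
  locally uniform limit, which lies in the space by Fatou.
\<close>

lemma dirichlet_bounded_sequence_convergent_subsequence:
  assumes \<alpha>: "\<alpha> < 1" and f: "\<And>n. f n \<in> dirichlet_space \<alpha>" and B: "\<And>n. dirichlet_norm \<alpha> (f n) \<le> B"
  obtains g r where "g \<in> dirichlet_space \<alpha>" "strict_mono (r :: nat \<Rightarrow> nat)"
    "dirichlet_energy \<alpha> g \<le> ennreal (B\<^sup>2)"
    "\<And>K. compact K \<Longrightarrow> K \<subseteq> ball 0 1 \<Longrightarrow> uniform_limit K (\<lambda>k. f (r k)) g sequentially"
proof -
  have hol: "f n holomorphic_on ball 0 1" for n using f[of n] by (simp add: dirichlet_space_def)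
  have B0: "0 \<le> B" using order_trans[OF dirichlet_norm_nonneg[OF f[of 0]] B[of 0]] .
  have loc: "\<exists>b. \<forall>h\<in>range f. \<forall>z\<in>K. cmod (h z) \<le> b" if K: "compact K" "K \<subseteq> ball 0 1" for K
  proof -
    have "continuous_on K (\<lambda>z. B / (1 - cmod z))"
      using K(2) by (intro continuous_intros) auto
    hence "bounded ((\<lambda>z. B / (1 - cmod z)) ` K)"
      by (intro compact_imp_bounded compact_continuous_image K)
    then obtain b where b: "\<And>z. z \<in> K \<Longrightarrow> \<bar>B / (1 - cmod z)\<bar> \<le> b"
      by (auto simp: bounded_iff)
    have "cmod (f n z) \<le> b" if z: "z \<in> K" for n z
    proof -
      have z1: "cmod z < 1" using z K(2) by auto
      have "cmod (f n z) \<le> dirichlet_norm \<alpha> (f n) / (1 - cmod z)" by (rule dirichlet_growth[OF f \<alpha> z1])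
      also have "\<dots> \<le> B / (1 - cmod z)" using z1 B by (intro divide_right_mono) auto
      also have "\<dots> \<le> b" using b[OF z] by linarith
      finally show ?thesis .
    qed
    thus ?thesis by blast
  qed
  obtain g r where g: "g holomorphic_on ball 0 1" and r: "strict_mono (r :: nat \<Rightarrow> nat)"
    and "\<And>x. x \<in> ball 0 1 \<Longrightarrow> ((\<lambda>n. f (r n) x) \<longlongrightarrow> g x) sequentially"
    and lim: "\<And>K. \<lbrakk>compact K; K \<subseteq> ball 0 1\<rbrakk> \<Longrightarrow> uniform_limit K (f \<circ> r) g sequentially"
  proof (rule Montel[OF open_ball _ loc order_refl])
    show "h holomorphic_on ball 0 1" if "h \<in> range f" for h using that hol by auto
  qed (assumption | rule that)+
  have lim': "uniform_limit K (\<lambda>k. f (r k)) g sequentially" if "compact K" "K \<subseteq> ball 0 1" for K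
    using lim[OF that] by (simp add: o_def)
  have "dirichlet_energy \<alpha> (f n) \<le> ennreal (B\<^sup>2)" for n
    by (rule dirichlet_energy_le_square[OF f B])
  hence E: "dirichlet_energy \<alpha> g \<le> ennreal (B\<^sup>2)"
    by (intro dirichlet_energy_le_of_coeff_limit[OF taylor_coeff_tendsto[OF lim' hol]]) auto
  hence "g \<in> dirichlet_space \<alpha>"
    using g by (auto simp: dirichlet_space_iff_energy intro: le_less_trans)
  thus ?thesis by (rule that[OF _ r E lim'])
qed

text \<open>
  Subtracting the locally uniform limit of a subsequence leaves a bounded sequence \<open>h k\<close> that tends to zero
  locally uniformly. In the assumed estimate first choose \<open>\<epsilon>\<close> so that the last term is small for all \<open>k\<close>; for the
  radius belonging to it the remaining terms tend to zero.
\<close>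

lemma compact_wcompI:
  assumes \<alpha>: "\<alpha> < 1" and \<phi>: "holo_self_map \<phi>" and \<psi>: "\<psi> holomorphic_on ball 0 1" and K: "K > 0"
    and est: "\<And>\<epsilon>. \<epsilon> > 0 \<Longrightarrow> \<exists>r. 0 < r \<and> r < 1 \<and> (\<forall>h M. h holomorphic_on ball 0 1 \<longrightarrow>
     (\<forall>z. cmod z \<le> r \<longrightarrow> cmod (deriv (deriv (wcomp \<psi> \<phi> h)) z) \<le> M) \<longrightarrow>
     dirichlet_energy \<alpha> (wcomp \<psi> \<phi> h) \<le>
       ennreal (dirichlet_term \<alpha> (wcomp \<psi> \<phi> h) 0 + dirichlet_term \<alpha> (wcomp \<psi> \<phi> h) 1 + K * M\<^sup>2)
       + ennreal (K * \<epsilon>\<^sup>2) * dirichlet_energy \<alpha> h)"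
    (is "\<And>\<epsilon>. _ \<Longrightarrow> \<exists>r. _ \<and> _ \<and> ?Q \<epsilon> r")
  shows "compact_operator_on_dirichlet \<alpha> (wcomp \<psi> \<phi>)"
proof -
  let ?T = "wcomp \<psi> \<phi>"
  have self: "\<phi> z \<in> ball 0 1" if "z \<in> ball 0 1" for z using holo_self_mapD(3)[OF \<phi> that] .
  have maps: "?T f \<in> dirichlet_space \<alpha>" if f: "f \<in> dirichlet_space \<alpha>" for f
  proof -
    have hf: "f holomorphic_on ball 0 1" and ef: "dirichlet_energy \<alpha> f < \<infinity>"
      using f by (auto simp: dirichlet_space_iff_energy)
    have hT: "?T f holomorphic_on ball 0 1" by (rule holomorphic_wcomp[OF \<psi> \<phi> hf])
    obtain r where "0 < r" and r: "r < 1" and e: "?Q 1 r"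
      by (rule exE[OF est[OF zero_less_one]], elim conjE, rule that)
    have "continuous_on (ball 0 1) (deriv (deriv (?T f)))"
      by (rule holomorphic_on_imp_continuous_on[OF holomorphic_deriv[OF holomorphic_deriv[OF hT open_ball] open_ball]])
    hence "continuous_on (cball 0 r) (deriv (deriv (?T f)))"
      by (rule continuous_on_subset) (use r in auto)
    hence "bounded (deriv (deriv (?T f)) ` cball 0 r)"
      by (intro compact_imp_bounded compact_continuous_image compact_cball)
    then obtain M where "\<forall>z\<in>cball 0 r. cmod (deriv (deriv (?T f)) z) \<le> M"
      by (auto simp: bounded_iff)
    hence M: "cmod (deriv (deriv (?T f)) z) \<le> M" if "cmod z \<le> r" for z
      using that by simp
    have "dirichlet_energy \<alpha> (?T f) \<le> ennreal (dirichlet_term \<alpha> (?T f) 0 + dirichlet_term \<alpha> (?T f) 1 + K * M\<^sup>2)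
       + ennreal (K * 1\<^sup>2) * dirichlet_energy \<alpha> f"
      by (rule e[rule_format, OF hf M])
    also have "ennreal (dirichlet_term \<alpha> (?T f) 0 + dirichlet_term \<alpha> (?T f) 1 + K * M\<^sup>2)
       + ennreal (K * 1\<^sup>2) * dirichlet_energy \<alpha> f < \<infinity>"
      using ef by (simp add: ennreal_mult_less_top)
    finally show ?thesis using hT by (simp add: dirichlet_space_iff_energy)
  qed
  have conv: "\<exists>g\<in>dirichlet_space \<alpha>. \<exists>r :: nat \<Rightarrow> nat. strict_mono r \<and>
      (\<lambda>n. dirichlet_norm \<alpha> (\<lambda>z. ?T (f (r n)) z - g z)) \<longlonglongrightarrow> 0"
    if f: "\<And>n. f n \<in> dirichlet_space \<alpha>" and B: "\<And>n. dirichlet_norm \<alpha> (f n) \<le> B" for f :: "nat \<Rightarrow> complex \<Rightarrow> complex" and B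
  proof -
    obtain g r where g: "g \<in> dirichlet_space \<alpha>" and r: "strict_mono (r :: nat \<Rightarrow> nat)"
      and Eg: "dirichlet_energy \<alpha> g \<le> ennreal (B\<^sup>2)"
      and lim: "\<And>K. compact K \<Longrightarrow> K \<subseteq> ball 0 1 \<Longrightarrow> uniform_limit K (\<lambda>k. f (r k)) g sequentially"
      by (rule dirichlet_bounded_sequence_convergent_subsequence[OF \<alpha> f B], rule that)
    have hg: "g holomorphic_on ball 0 1" and hf: "\<And>n. f n holomorphic_on ball 0 1"
      using g f by (auto simp: dirichlet_space_def)
    define h where "h = (\<lambda>k z. f (r k) z - g z)"
    have hh: "h k holomorphic_on ball 0 1" for k unfolding h_def by (intro holomorphic_on_diff hf hg)
    have Ef: "dirichlet_energy \<alpha> (f n) \<le> ennreal (B\<^sup>2)" for n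
      by (rule dirichlet_energy_le_square[OF f B])
    have Eh: "dirichlet_energy \<alpha> (h k) \<le> ennreal (4 * B\<^sup>2)" for k
    proof -
      have "dirichlet_energy \<alpha> (h k) \<le> 2 * (dirichlet_energy \<alpha> (f (r k)) + dirichlet_energy \<alpha> g)"
        unfolding h_def by (rule dirichlet_energy_diff_le[OF hf hg])
      also have "\<dots> \<le> 2 * (ennreal (B\<^sup>2) + ennreal (B\<^sup>2))" by (intro mult_left_mono add_mono Ef Eg) auto
      also have "\<dots> = ennreal 2 * ennreal (B\<^sup>2 + B\<^sup>2)" by (simp only: ennreal_plus zero_le_power2 ennreal_numeral)
      also have "\<dots> = ennreal (2 * (B\<^sup>2 + B\<^sup>2))" by (rule ennreal_mult[symmetric]) auto
      also have "2 * (B\<^sup>2 + B\<^sup>2) = 4 * B\<^sup>2" by simp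
      finally show ?thesis .
    qed
    have hD: "h k \<in> dirichlet_space \<alpha>" for k
      using hh le_less_trans[OF Eh[of k] ennreal_less_top] by (simp add: dirichlet_space_iff_energy)
    have lim0: "uniform_limit K h (\<lambda>_. 0) sequentially" if "compact K" "K \<subseteq> ball 0 1" for K
      using lim[OF that] unfolding uniform_limit_iff h_def by (simp add: dist_norm)
    define F where "F = (\<lambda>k. ?T (h k))"
    have hF: "F k holomorphic_on ball 0 1" for k unfolding F_def by (rule holomorphic_wcomp[OF \<psi> \<phi> hh])
    have limF: "uniform_limit K F (\<lambda>_. 0) sequentially" if "compact K" "K \<subseteq> ball 0 1" for K
      unfolding F_def by (rule wcomp_uniform_limit[OF \<psi> \<phi> lim0 that])
    have c0: "(\<lambda>k. taylor_coeff (F k) n) \<longlonglongrightarrow> 0" for n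
      using taylor_coeff_tendsto[OF limF hF, of n] by (simp add: taylor_coeff_def)
    have t0: "(\<lambda>k. dirichlet_term \<alpha> (F k) n) \<longlonglongrightarrow> 0" for n
    proof -
      have "(\<lambda>k. (real n + 1) powr (1 - \<alpha>) * (cmod (taylor_coeff (F k) n))\<^sup>2) \<longlonglongrightarrow> (real n + 1) powr (1 - \<alpha>) * (cmod 0)\<^sup>2"
        by (intro tendsto_intros c0)
      thus ?thesis by (simp add: dirichlet_term_taylor)
    qed
    have small: "eventually (\<lambda>k. (dirichlet_norm \<alpha> (F k))\<^sup>2 \<le> \<delta>) sequentially" if \<delta>: "\<delta> > 0" for \<delta>
    proof -
      \<comment> \<open>The energy of \<open>h k\<close> is at most \<open>4 * B\<^sup>2\<close>, so this \<open>\<epsilon>\<close> bounds the last term by \<open>\<delta> / 2\<close> (adding one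
        avoids division by zero for \<open>B = 0\<close>); each of the other three gets \<open>\<delta> / 8\<close>.\<close>
      define \<epsilon> where "\<epsilon> = sqrt (\<delta> / (8 * K * (B\<^sup>2 + 1)))"
      define M where "M = sqrt (\<delta> / (8 * K))"
      have B1: "B\<^sup>2 + 1 > 0" by (simp add: add_nonneg_pos)
      have \<epsilon>: "\<epsilon> > 0" unfolding \<epsilon>_def using \<delta> K B1 by simp
      have M: "M > 0" unfolding M_def using \<delta> K by simp
      have \<epsilon>2: "\<epsilon>\<^sup>2 = \<delta> / (8 * K * (B\<^sup>2 + 1))" unfolding \<epsilon>_def using \<delta> K B1 by (intro real_sqrt_pow2) simp
      have M2: "K * M\<^sup>2 = \<delta> / 8" unfolding M_def using \<delta> K by simp
      have Ke: "K * \<epsilon>\<^sup>2 * (4 * B\<^sup>2) \<le> \<delta> / 2"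
      proof -
        have "K * \<epsilon>\<^sup>2 * (4 * B\<^sup>2) = \<delta> / 2 * (B\<^sup>2 / (B\<^sup>2 + 1))"
          unfolding \<epsilon>2 using K B1 by (simp add: divide_simps)
        also have "\<dots> \<le> \<delta> / 2 * 1" using \<delta> B1 by (intro mult_left_mono) auto
        finally show ?thesis by simp
      qed
      obtain s where s: "0 < s" "s < 1" and e: "?Q \<epsilon> s"
        by (rule exE[OF est[OF \<epsilon>]], elim conjE, rule that)
      have ev: "eventually (\<lambda>k. dirichlet_term \<alpha> (F k) n < \<delta> / 8) sequentially" for n
        using order_tendstoD(2)[OF t0[of n], of "\<delta> / 8"] \<delta> by simp
      have "eventually (\<lambda>k. \<forall>z. cmod z \<le> s \<longrightarrow> cmod (deriv (deriv (F k)) z) \<le> M) sequentially"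
        by (rule deriv2_uniformly_small[OF hF _ s M]) (rule limF)
      thus ?thesis
        using ev[of 0] ev[of 1]
      proof eventually_elim
        fix k
        assume d2: "\<forall>z. cmod z \<le> s \<longrightarrow> cmod (deriv (deriv (F k)) z) \<le> M"
          and t: "dirichlet_term \<alpha> (F k) 0 < \<delta> / 8" "dirichlet_term \<alpha> (F k) 1 < \<delta> / 8"
        have "dirichlet_energy \<alpha> (F k) \<le> ennreal (dirichlet_term \<alpha> (F k) 0 + dirichlet_term \<alpha> (F k) 1 + K * M\<^sup>2)
          + ennreal (K * \<epsilon>\<^sup>2) * dirichlet_energy \<alpha> (h k)" 
          unfolding F_def by (rule e[rule_format, OF hh]) (use d2 in \<open>simp add: F_def\<close>)
        also have "\<dots> \<le> ennreal (\<delta> / 2) + ennreal (K * \<epsilon>\<^sup>2) * ennreal (4 * B\<^sup>2)"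
          using t M2 \<delta> by (intro add_mono mult_left_mono Eh ennreal_leI) auto
        also have "\<dots> = ennreal (\<delta> / 2 + K * \<epsilon>\<^sup>2 * (4 * B\<^sup>2))"
          using K \<delta> by (subst ennreal_plus) (auto simp: ennreal_mult)
        also have "\<dots> \<le> ennreal \<delta>" using Ke by (intro ennreal_leI) linarith
        finally have "ennreal ((dirichlet_norm \<alpha> (F k))\<^sup>2) \<le> ennreal \<delta>"
          using dirichlet_energy_eq_norm[OF maps[OF hD[of k]]] by (simp add: F_def)
        thus "(dirichlet_norm \<alpha> (F k))\<^sup>2 \<le> \<delta>" using \<delta> by simp
      qed
    qed
    have sq0: "(\<lambda>k. (dirichlet_norm \<alpha> (F k))\<^sup>2) \<longlonglongrightarrow> 0"
    proof (rule tendstoI)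
      fix e :: real assume "e > 0"
      hence "eventually (\<lambda>k. (dirichlet_norm \<alpha> (F k))\<^sup>2 \<le> e / 2) sequentially" by (intro small) simp
      thus "eventually (\<lambda>k. dist ((dirichlet_norm \<alpha> (F k))\<^sup>2) 0 < e) sequentially"
        using \<open>e > 0\<close> by (elim eventually_mono) (auto simp: dist_real_def)
    qed
    have nn: "0 \<le> dirichlet_norm \<alpha> (F k)" for k
      unfolding F_def by (rule dirichlet_norm_nonneg[OF maps[OF hD]])
    have "(\<lambda>k. dirichlet_norm \<alpha> (F k)) \<longlonglongrightarrow> 0"
      using tendsto_real_sqrt[OF sq0] nn by simp
    moreover have "F k = (\<lambda>z. ?T (f (r k)) z - ?T g z)" for k
      by (simp add: F_def h_def wcomp_def fun_eq_iff algebra_simps)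
    ultimately show ?thesis using maps[OF g] r by auto
  qed
  show ?thesis
    unfolding compact_operator_on_dirichlet_def
  proof (intro conjI ballI allI impI)
    show "?T f \<in> dirichlet_space \<alpha>" if "f \<in> dirichlet_space \<alpha>" for f by (rule maps[OF that])
    show "?T f z = ?T g z" if "\<forall>z\<in>unit_disc. f z = g z" "z \<in> unit_disc" for f g z
      using that self[OF that(2)] by (simp only: wcomp_def)
    show "?T (\<lambda>w. a * f w + b * g w) z = a * ?T f z + b * ?T g z" for a b f g z
      by (simp add: wcomp_def algebra_simps)
    show "\<exists>g\<in>dirichlet_space \<alpha>. \<exists>r :: nat \<Rightarrow> nat. strict_mono r \<and>
      (\<lambda>n. dirichlet_norm \<alpha> (\<lambda>z. ?T (f (r n)) z - g z)) \<longlonglongrightarrow> 0"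
      if bd: "(\<forall>n. f n \<in> dirichlet_space \<alpha>) \<and> (\<exists>B. \<forall>n. dirichlet_norm \<alpha> (f n) \<le> B)" for f :: "nat \<Rightarrow> complex \<Rightarrow> complex"
    proof -
      obtain B where "\<And>n. dirichlet_norm \<alpha> (f n) \<le> B" using bd by blast
      thus ?thesis using conv[of f B] bd by blast
    qed
  qed
qed

theorem theorem1p2:
  fixes \<alpha> :: real and \<phi> \<psi> :: "complex \<Rightarrow> complex"
  assumes "-1 < \<alpha>" and "\<alpha> < 1"
    and "holo_self_map \<phi>" and "inj_on \<phi> unit_disc"
    and "\<psi> holomorphic_on unit_disc"
    and "((\<lambda>z. cmod ((deriv ^^ 2) \<psi> z) * (1 - (cmod z)\<^sup>2)) \<longlongrightarrow> 0) to_unit_circle"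
    and "((\<lambda>z. cmod (deriv \<phi> z * deriv \<psi> z) * (1 - (cmod z)\<^sup>2)) \<longlongrightarrow> 0) to_unit_circle"
    and "((\<lambda>z. cmod ((deriv ^^ 2) \<phi> z * \<psi> z) * (1 - (cmod z)\<^sup>2)) \<longlongrightarrow> 0) to_unit_circle"
    and "((\<lambda>z. cmod (deriv \<phi> z * \<psi> z) *
            ((1 - (cmod z)\<^sup>2) / (1 - (cmod (\<phi> z))\<^sup>2)) powr (\<alpha> / 2 + 1)) \<longlongrightarrow> 0) to_unit_circle"
  shows "compact_operator_on_dirichlet \<alpha> (wcomp \<psi> \<phi>)"
proof (rule wcomp_energy_estimate[OF assms], goal_cases)
  case (1 K)
  show ?case by (rule compact_wcompI[OF assms(2,3,5) 1(1) 1(2)])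
qed

end
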